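(* Let $G$ be a periodic compactly ruled locally compact group and let $\nu(G)=\{p\in\pi: [G_p,G_{p'}]=\{1\}\}$. Then the set $G_{\nu(G)'}$ of $\nu(G)'$-elements (where $\nu(G)'=\pi\setminus\nu(G)$) is a closed normal subgroup of $G$, for each $p\in\nu(G)$ the set $G_p$ is a normal $p$-Sylow subgroup, and there is a family of compact open subgroups $U_p\subseteq G_p$, $p\in\nu(G)$, such that $$G\cong G_{\nu(G)'}\times\prod_{p\in\nu(G)}^{\mathrm{loc}}(G_p,U_p).$$
   Context: $\pi$ is the set of all primes, $p'=\pi\setminus\{p\}$. A topological group $G$ is periodic if it is locally compact, totally disconnected, and $\overline{\langle g\rangle}$ is compact for every $g$; it is compactly ruled if it is the directed union of its compact open subgroups. For $g\in G$, $\overline{\langle g\rangle}\cong\prod_p M_p$ with $M_p$ its $p$-primary component; for a set $\sigma$ of primes, $g$ is a $\sigma$-element if $M_q=\{1\}$ for $q\notin\sigma$; $G_\sigma$ is the set of $\sigma$-elements and $G_p=G_{\{p\}}$; a $\sigma$-Sylow subgroup is a maximal subgroup consisting of $\sigma$-elements. Local product: for locally compact groups $G_j$ ($j\in J$) with compact open subgroups $C_j$, $\prod^{\mathrm{loc}}_{j\in J}(G_j,C_j)$ is the subgroup of $\prod_j G_j$ of tuples $(g_j)$ with $g_j\notin C_j$ for only finitely many $j$, endowed with the unique group topology in which $\prod_j C_j$ (with the Tychonoff topology) is an open subgroup. *)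

theory Defs
  imports "HOL-Analysis.Analysis" "HOL-Algebra.Algebra"
begin

definition topological_group :: "'a monoid \<Rightarrow> 'a topology \<Rightarrow> bool" where
  "topological_group G T \<longleftrightarrow> group G \<and> topspace T = carrier G \<and>
     continuous_map (prod_topology T T) T (\<lambda>(x, y). mult G x y) \<and>
     continuous_map T T (m_inv G)"

definition totally_disconnected_space :: "'a topology \<Rightarrow> bool" where
  "totally_disconnected_space Y \<longleftrightarrow> (\<forall>C. connectedin Y C \<longrightarrow> (\<exists>z. C \<subseteq> {z}))"

text \<open>Locally compact groups are Hausdorff by convention.\<close>
definition locally_compact_group :: "'a monoid \<Rightarrow> 'a topology \<Rightarrow> bool" where
  "locally_compact_group G T \<longleftrightarrow> topological_group G T \<and> Hausdorff_space T \<and>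
     locally_compact_space T"

definition mono_closure :: "'a monoid \<Rightarrow> 'a topology \<Rightarrow> 'a \<Rightarrow> 'a set" where
  "mono_closure G T g = T closure_of (generate G {g})"

definition periodic_group :: "'a monoid \<Rightarrow> 'a topology \<Rightarrow> bool" where
  "periodic_group G T \<longleftrightarrow> locally_compact_group G T \<and> totally_disconnected_space T \<and>
     (\<forall>g\<in>carrier G. compactin T (mono_closure G T g))"

definition compact_open_subgroup :: "'a monoid \<Rightarrow> 'a topology \<Rightarrow> 'a set \<Rightarrow> bool" where
  "compact_open_subgroup G T U \<longleftrightarrow> subgroup U G \<and> compactin T U \<and> openin T U"

definition compactly_ruled :: "'a monoid \<Rightarrow> 'a topology \<Rightarrow> bool" where
  "compactly_ruled G T \<longleftrightarrow>
     carrier G = \<Union>{U. compact_open_subgroup G T U} \<and>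
     (\<forall>U V. compact_open_subgroup G T U \<and> compact_open_subgroup G T V \<longrightarrow>
        (\<exists>W. compact_open_subgroup G T W \<and> U \<union> V \<subseteq> W))"

definition primary_comp :: "'a monoid \<Rightarrow> 'a topology \<Rightarrow> 'a \<Rightarrow> nat \<Rightarrow> 'a set" where
  "primary_comp G T g p =
     {x \<in> mono_closure G T g. limitin T (\<lambda>n. x [^]\<^bsub>G\<^esub> (p ^ n)) \<one>\<^bsub>G\<^esub> sequentially}"

definition sigma_element :: "'a monoid \<Rightarrow> 'a topology \<Rightarrow> nat set \<Rightarrow> 'a \<Rightarrow> bool" where
  "sigma_element G T \<sigma> g \<longleftrightarrow> g \<in> carrier G \<and>
     (\<forall>q. Factorial_Ring.prime q \<and> q \<notin> \<sigma> \<longrightarrow> primary_comp G T g q = {\<one>\<^bsub>G\<^esub>})"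

definition G_sigma :: "'a monoid \<Rightarrow> 'a topology \<Rightarrow> nat set \<Rightarrow> 'a set" where
  "G_sigma G T \<sigma> = {g. sigma_element G T \<sigma> g}"

definition G_p :: "'a monoid \<Rightarrow> 'a topology \<Rightarrow> nat \<Rightarrow> 'a set" where
  "G_p G T p = G_sigma G T {p}"

definition sigma_sylow :: "'a monoid \<Rightarrow> 'a topology \<Rightarrow> nat set \<Rightarrow> 'a set \<Rightarrow> bool" where
  "sigma_sylow G T \<sigma> H \<longleftrightarrow> subgroup H G \<and> H \<subseteq> G_sigma G T \<sigma> \<and>
     (\<forall>K. subgroup K G \<and> K \<subseteq> G_sigma G T \<sigma> \<and> H \<subseteq> K \<longrightarrow> K = H)"

definition commutator_group :: "'a monoid \<Rightarrow> 'a set \<Rightarrow> 'a set \<Rightarrow> 'a set" where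
  "commutator_group G A B = generate G
     {a \<otimes>\<^bsub>G\<^esub> b \<otimes>\<^bsub>G\<^esub> inv\<^bsub>G\<^esub> a \<otimes>\<^bsub>G\<^esub> inv\<^bsub>G\<^esub> b | a b. a \<in> A \<and> b \<in> B}"

definition nu :: "'a monoid \<Rightarrow> 'a topology \<Rightarrow> nat set" where
  "nu G T = {p. Factorial_Ring.prime p \<and>
     commutator_group G (G_p G T p) (G_sigma G T ({q. Factorial_Ring.prime q} - {p})) = {\<one>\<^bsub>G\<^esub>}}"

definition loc_prod_carrier ::
  "'i set \<Rightarrow> ('i \<Rightarrow> 'a monoid) \<Rightarrow> ('i \<Rightarrow> 'a set) \<Rightarrow> ('i \<Rightarrow> 'a) set" where
  "loc_prod_carrier I Gs C = {f \<in> (\<Pi>\<^sub>E j\<in>I. carrier (Gs j)). finite {j \<in> I. f j \<notin> C j}}"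

definition loc_prod_group ::
  "'i set \<Rightarrow> ('i \<Rightarrow> 'a monoid) \<Rightarrow> ('i \<Rightarrow> 'a set) \<Rightarrow> ('i \<Rightarrow> 'a) monoid" where
  "loc_prod_group I Gs C = (product_group I Gs)\<lparr>carrier := loc_prod_carrier I Gs C\<rparr>"

text \<open>The group topology in which the product of the C j, with the Tychonoff topology,
  is an open subgroup: O is open iff for each x in O, the set of u in the product of the C j
  with x u in O is open in the Tychonoff topology.\<close>
definition loc_prod_topology ::
  "'i set \<Rightarrow> ('i \<Rightarrow> 'a monoid) \<Rightarrow> ('i \<Rightarrow> 'a topology) \<Rightarrow> ('i \<Rightarrow> 'a set) \<Rightarrow> ('i \<Rightarrow> 'a) topology" where
  "loc_prod_topology I Gs Xs C = topology (\<lambda>W. W \<subseteq> loc_prod_carrier I Gs C \<and>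
     (\<forall>x\<in>W. openin (product_topology (\<lambda>j. subtopology (Xs j) (C j)) I)
               {u \<in> (\<Pi>\<^sub>E j\<in>I. C j). x \<otimes>\<^bsub>product_group I Gs\<^esub> u \<in> W}))"

end

theory Submission
  imports Defs
begin

text \<open>
  A compact open subgroup \<open>U\<close> has arbitrarily small open normal subgroups \<open>N\<close>, and \<open>g\<close> is a
  \<open>\<sigma>\<close>-element iff its order modulo every open subgroup is a \<open>\<sigma>\<close>-number. If \<open>\<sigma>\<close>-elements commute
  with \<open>\<sigma>'\<close>-elements, the same holds in the finite groups \<open>U / N\<close>, where the transfer into a central
  Hall subgroup shows that \<open>\<sigma>\<close>-elements are closed under products; hence \<open>G\<^sub>\<sigma>\<close> is a closed normal
  subgroup of \<open>G\<close>. Each \<open>g\<close> is a product of a \<open>\<sigma>\<close>-element and a \<open>\<sigma>'\<close>-element of the closure of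
  \<open>\<langle>g\<rangle>\<close>, so the projection onto \<open>G\<^sub>\<sigma>\<close> is a homomorphism mapping every open subgroup into itself,
  and is therefore continuous. The isomorphism collects the projections onto \<open>G\<^sub>p\<close> for \<open>p \<in> \<nu>(G)\<close> and
  onto the \<open>\<nu>(G)'\<close>-part, with \<open>U\<^sub>p = U \<inter> G\<^sub>p\<close>; surjectivity and openness come from compactness
  of \<open>U\<close>.
\<close>

section \<open>Torsion in finite groups\<close>

text \<open>The obstacle is closure under products: two \<sigma>-elements need not commute with each
  other, and their commuting with all \<sigma>'-elements says nothing directly about their product.
  Finite quotients of compact open subgroups reduce this to finite groups, but torsion elements of
  such a quotient must be lifted to genuine \<sigma>-elements before the commutation in
  \<open>G\<close> can be used; \<open>pi_element_lift\<close> does this. A second gap is that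
  \<open>nu\<close> speaks of one prime at a time, while the factor for \<nu>(G)' needs commutation
  for the possibly infinite set \<nu>(G) as a whole; modulo an open subgroup normal in a compact
  open one, only finitely many primes of an element remain visible (\<open>pi_split_Union\<close>).
  Complements are taken in the naturals, as \<open>- \<sigma>\<close>: only the primes in a set
  matter, and \<open>- (- \<sigma>) = \<sigma>\<close> keeps all statements symmetric. The value 0
  is excluded in \<open>pi_number\<close> because it would pass the prime test when \<sigma>
  contains all primes, and then count as an exponent of every element.\<close>

definition pi_number :: "nat set \<Rightarrow> nat \<Rightarrow> bool" where
  "pi_number \<sigma> n \<longleftrightarrow> n > 0 \<and> (\<forall>q. Factorial_Ring.prime q \<and> q dvd n \<longrightarrow> q \<in> \<sigma>)"

lemma pi_number_1 [simp]: "pi_number \<sigma> 1" "pi_number \<sigma> (Suc 0)"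
  by (auto simp: pi_number_def)

lemma pi_number_mult: "pi_number \<sigma> m \<Longrightarrow> pi_number \<sigma> n \<Longrightarrow> pi_number \<sigma> (m * n)"
  by (auto simp: pi_number_def prime_dvd_mult_iff)

lemma pi_number_dvd: "pi_number \<sigma> n \<Longrightarrow> m dvd n \<Longrightarrow> pi_number \<sigma> m"
  unfolding pi_number_def by (meson dvd_trans dvd_pos_nat)

lemma pi_number_mono: "pi_number \<sigma> n \<Longrightarrow> \<sigma> \<subseteq> \<tau> \<Longrightarrow> pi_number \<tau> n"
  by (auto simp: pi_number_def)

lemma pi_number_prime_power: "Factorial_Ring.prime p \<Longrightarrow> p \<in> \<sigma> \<Longrightarrow> pi_number \<sigma> (p ^ k)"
  by (auto simp: pi_number_def prime_gt_0_nat dest: prime_dvd_power_nat primes_dvd_imp_eq)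

lemma pi_number_coprime: "pi_number \<sigma> m \<Longrightarrow> pi_number (- \<sigma>) n \<Longrightarrow> coprime m n"
  unfolding pi_number_def
  by (metis ComplD coprime_iff_gcd_eq_1 gcd_dvd1 gcd_dvd2 dvd_trans prime_factor_nat)

text \<open>Supplies the exponents \<open>s\<close> and \<open>t\<close> from which \<sigma>-parts
  and complementary parts are cut out; strong induction sorts one prime factor of \<open>n\<close>
  at a time.\<close>

lemma pi_number_split:
  assumes "n > 0"
  obtains s t where "n = s * t" "pi_number \<sigma> s" "pi_number (- \<sigma>) t"
proof -
  have "\<exists>s t. n = s * t \<and> pi_number \<sigma> s \<and> pi_number (- \<sigma>) t"
    using assms
  proof (induction n rule: less_induct)
    case (less n)
    show ?case
    proof (cases "n = 1")
      case True
      then show ?thesis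
        by (metis mult_1 pi_number_1(1))
    next
      case False
      then obtain q where q: "Factorial_Ring.prime q" "q dvd n"
        using prime_factor_nat by blast
      then obtain k where k: "n = q * k" by blast
      with less.prems q have "k > 0" "k < n"
        using prime_gt_1_nat[OF q(1)] by auto
      then obtain s t where st: "k = s * t" "pi_number \<sigma> s" "pi_number (- \<sigma>) t"
        using less.IH by blast
      show ?thesis
      proof (cases "q \<in> \<sigma>")
        case True
        then have "pi_number \<sigma> (q * s)"
          using pi_number_mult[OF pi_number_prime_power[OF q(1) True, of 1] st(2)] by simp
        then show ?thesis
          using k st by (metis mult.assoc)
      next
        case False
        then have "pi_number (- \<sigma>) (q * t)"
          using pi_number_mult[OF pi_number_prime_power[OF q(1), of "- \<sigma>" 1] st(3)] by simp
        then show ?thesis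
          using k st by (metis mult.left_commute)
      qed
    qed
  qed
  then show ?thesis using that by blast
qed

lemma pi_number_singleton:
  assumes "Factorial_Ring.prime p" "pi_number {p} n"
  obtains k where "n = p ^ k"
proof -
  have n: "n \<noteq> 0" "\<not> is_unit p"
    using assms by (auto simp: pi_number_def)
  then obtain m where m: "n = p ^ multiplicity p n * m" "\<not> p dvd m"
    using multiplicity_decompose' by metis
  have "m = 1"
    using prime_factor_nat[of m] m assms unfolding pi_number_def
    by (metis dvd_triv_right dvd_trans singletonD)
  with m that show thesis by (metis mult_1_right)
qed

section \<open>Exponents modulo a subgroup, transfer, and torsion in abstract groups\<close>

context group
begin

lemma subgroup_nat_pow_closed: "subgroup V G \<Longrightarrow> x \<in> V \<Longrightarrow> x [^] (n::nat) \<in> V"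
  by (induction n) (auto simp: subgroup.one_closed subgroup.m_closed)

lemma commute_inv:
  assumes "x \<in> carrier G" "y \<in> carrier G" "x \<otimes> y = y \<otimes> x"
  shows "inv x \<otimes> y = y \<otimes> inv x"
proof -
  have "inv x \<otimes> y = inv x \<otimes> (y \<otimes> x) \<otimes> inv x"
    using assms(1,2) by (simp add: m_assoc)
  also have "\<dots> = inv x \<otimes> (x \<otimes> y) \<otimes> inv x"
    using assms(3) by simp
  also have "\<dots> = y \<otimes> inv x"
    using assms(1,2) by (simp add: m_assoc[symmetric])
  finally show ?thesis .
qed

lemma commute_mult:
  assumes "x \<in> carrier G" "y \<in> carrier G" "z \<in> carrier G"
    "x \<otimes> z = z \<otimes> x" "y \<otimes> z = z \<otimes> y"
  shows "x \<otimes> y \<otimes> z = z \<otimes> (x \<otimes> y)"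
proof -
  have "x \<otimes> y \<otimes> z = x \<otimes> z \<otimes> y" using assms(1-3) by (simp add: assms(5) m_assoc)
  also have "\<dots> = z \<otimes> x \<otimes> y" by (simp only: assms(4))
  also have "\<dots> = z \<otimes> (x \<otimes> y)" by (rule m_assoc[OF assms(3,1,2)])
  finally show ?thesis .
qed

text \<open>Bezout writes \<open>a\<close> as a product of powers of \<open>a [^] m\<close> and
  \<open>a [^] n\<close>. Applied to a \<sigma>-number and a number prime to \<sigma>, it puts every
  element with both kinds of exponent modulo \<open>V\<close> into \<open>V\<close>.\<close>

lemma coprime_pow_in_subgroup:
  fixes m n :: nat
  assumes V: "subgroup V G" and a: "a \<in> carrier G" and "coprime m n"
    and "a [^] m \<in> V" "a [^] n \<in> V"
  shows "a \<in> V"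
proof -
  obtain u v where uv: "u * int m + v * int n = 1"
    using bezout_int[of "int m" "int n"] assms(3) by (metis coprime_imp_gcd_eq_1 coprime_int_iff)
  have "a = a [^] (int m * u + int n * v)"
    using uv a by (simp add: mult.commute)
  also have "\<dots> = (a [^] m) [^] u \<otimes> (a [^] n) [^] v"
    using a by (simp add: int_pow_mult int_pow_pow[symmetric] int_pow_int)
  also have "\<dots> \<in> V"
    using assms by (intro subgroup.m_closed[OF V] subgroup_int_pow_closed[OF V])
  finally show ?thesis .
qed

lemma coprime_pow_eq_one:
  fixes m n :: nat
  assumes "a \<in> carrier G" "coprime m n" "a [^] m = \<one>" "a [^] n = \<one>"
  shows "a = \<one>"
  using coprime_pow_in_subgroup[OF triv_subgroup assms(1,2)] assms by simp

text \<open>Division with remainder by the least positive exponent. It replaces the order of a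
  coset, which would require a normal \<open>V\<close>.\<close>

lemma order_modulo_subgroup:
  assumes V: "subgroup V G" and a: "a \<in> carrier G" and n: "(n::nat) > 0" "a [^] n \<in> V"
  obtains d :: nat where "d > 0" "\<forall>m::nat. a [^] m \<in> V \<longleftrightarrow> d dvd m"
proof -
  define d where "d = (LEAST k::nat. k > 0 \<and> a [^] k \<in> V)"
  have d: "d > 0" "a [^] d \<in> V"
    using LeastI[of "\<lambda>k::nat. k > 0 \<and> a [^] k \<in> V" n] n by (auto simp: d_def)
  have "a [^] m \<in> V \<longleftrightarrow> d dvd m" for m :: nat
  proof
    assume m: "a [^] m \<in> V"
    have "a [^] m = (a [^] d) [^] (m div d) \<otimes> a [^] (m mod d)"
      using a by (simp add: nat_pow_pow nat_pow_mult)
    then have "a [^] (m mod d) = inv ((a [^] d) [^] (m div d)) \<otimes> a [^] m"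
      using a by (simp add: inv_solve_left)
    also have "\<dots> \<in> V"
      using m d V by (simp add: subgroup.m_closed subgroup.m_inv_closed subgroup_nat_pow_closed)
    finally have "\<not> m mod d > 0"
      using not_less_Least[of "m mod d" "\<lambda>k::nat. k > 0 \<and> a [^] k \<in> V"] d(1)
      by (auto simp: d_def[symmetric])
    then show "d dvd m" by auto
  next
    assume "d dvd m"
    then obtain k where "m = d * k" by blast
    then show "a [^] m \<in> V"
      using d(2) a V by (simp add: nat_pow_pow[symmetric] subgroup_nat_pow_closed)
  qed
  with d(1) that show thesis by blast
qed

text \<open>The abstract counterpart of \<open>pi_element\<close>, meant for finite quotients, where
  no topology is left.\<close>

definition pi_torsion :: "nat set \<Rightarrow> 'a set" where
  "pi_torsion \<sigma> = {x \<in> carrier G. \<exists>n. pi_number \<sigma> n \<and> x [^] n = \<one>}"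

lemma pi_torsion_commuting_mult:
  assumes "x \<in> pi_torsion \<sigma>" "y \<in> pi_torsion \<sigma>" "x \<otimes> y = y \<otimes> x"
  shows "x \<otimes> y \<in> pi_torsion \<sigma>"
proof -
  obtain m n where mn: "pi_number \<sigma> m" "x [^] m = \<one>" "pi_number \<sigma> n" "y [^] n = \<one>"
    and xy: "x \<in> carrier G" "y \<in> carrier G"
    using assms by (auto simp: pi_torsion_def)
  have "(x \<otimes> y) [^] (m * n) = x [^] (m * n) \<otimes> y [^] (n * m)"
    using pow_mult_distrib[OF assms(3) xy, of "m * n"] by (simp add: mult.commute)
  also have "\<dots> = \<one>"
    using mn xy by (simp add: nat_pow_pow[symmetric])
  finally show ?thesis
    using mn xy pi_number_mult by (auto simp: pi_torsion_def)
qed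

lemma pi_torsion_inv:
  assumes "x \<in> pi_torsion \<sigma>" shows "inv x \<in> pi_torsion \<sigma>"
  using assms by (auto simp: pi_torsion_def nat_pow_inv)

lemma pi_torsion_disjoint:
  assumes "x \<in> pi_torsion \<sigma>" "x \<in> pi_torsion (- \<sigma>)" shows "x = \<one>"
  using assms by (auto simp: pi_torsion_def intro: coprime_pow_eq_one pi_number_coprime)

text \<open>The transfer into a central subgroup, as a product of the cocycle of a section.\<close>
lemma central_transfer:
  assumes fin: "finite (carrier G)" and Z: "subgroup Z G"
    and central: "\<And>z x. z \<in> Z \<Longrightarrow> x \<in> carrier G \<Longrightarrow> z \<otimes> x = x \<otimes> z"
  obtains \<tau> where "\<tau> \<in> hom G (G\<lparr>carrier := Z\<rparr>)"
    "\<And>z. z \<in> Z \<Longrightarrow> \<tau> z = z [^] card (rcosets Z)"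
proof -
  let ?ZG = "G\<lparr>carrier := Z\<rparr>"
  have Zc: "Z \<subseteq> carrier G" using Z subgroup.subset by blast
  interpret ZG: comm_group ?ZG
    by (rule group.group_comm_groupI) (use subgroup_imp_group[OF Z] central Zc in auto)
  have swap: "a \<otimes> (z \<otimes> b) = z \<otimes> (a \<otimes> b)" if "z \<in> Z" "a \<in> carrier G" "b \<in> carrier G" for a b z
    using central[OF that(1,2)] that Zc by (simp add: m_assoc[symmetric] subset_iff)
  have absorb: "Z #> (z \<otimes> a) = Z #> a" if "z \<in> Z" "a \<in> carrier G" for a z
    using coset_mult_assoc[OF Zc, of z a] coset_join2[OF _ Z, of z] that Zc by auto
  \<comment> \<open>A transversal: one representative of each coset of \<open>Z\<close>.\<close>
  define s where "s c = (SOME y. y \<in> c)" for c :: "'a set"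
  have s: "s c \<in> c" if "c \<in> rcosets Z" for c
  proof -
    from that obtain y where "y \<in> carrier G" "c = Z #> y" by (auto simp: RCOSETS_def)
    then have "y \<in> c" using rcos_self[OF _ Z] by simp
    then show ?thesis unfolding s_def by (rule someI)
  qed
  have sc: "s c \<in> carrier G" if "c \<in> rcosets Z" for c
    using s[OF that] subgroup.rcosets_carrier[OF Z is_group that] by blast
  have finC: "finite (rcosets Z)"
    using fin by (simp add: RCOSETS_def)
  define act where "act x c = Z #> (x \<otimes> s c)" for x c
  \<comment> \<open>\<open>x\<close> moves the coset of \<open>s c\<close> to
    \<open>act x c\<close>, and \<open>\<zeta> x c\<close> is the element of \<open>Z\<close> by
    which \<open>x \<otimes> s c\<close> differs from the representative chosen there.\<close>
  define \<zeta> where "\<zeta> x c = x \<otimes> s c \<otimes> inv (s (act x c))" for x c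
  have act: "act x c \<in> rcosets Z" if "x \<in> carrier G" "c \<in> rcosets Z" for x c
    using that sc Zc by (auto simp: act_def intro!: rcosetsI)
  have in_act: "\<exists>z\<in>Z. s (Z #> y) = z \<otimes> y" if "y \<in> carrier G" for y
    using s[OF rcosetsI[OF Zc that]] by (auto simp: r_coset_def)
  have \<zeta>Z: "\<zeta> x c \<in> Z" if x: "x \<in> carrier G" and c: "c \<in> rcosets Z" for x c
  proof -
    obtain z where z: "z \<in> Z" "s (act x c) = z \<otimes> (x \<otimes> s c)"
      using in_act[of "x \<otimes> s c"] x sc[OF c] by (auto simp: act_def)
    then have "\<zeta> x c = (x \<otimes> s c) \<otimes> (inv (x \<otimes> s c) \<otimes> inv z)"
      using x sc[OF c] Zc unfolding \<zeta>_def by (metis inv_mult_group m_closed subsetD)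
    then have "\<zeta> x c = inv z"
      using x sc[OF c] z(1) Zc by (simp add: m_assoc[symmetric] subset_iff r_inv del: inv_mult_group)
    then show ?thesis using z Z by (simp add: subgroup.m_inv_closed)
  qed
  have \<zeta>eq: "x \<otimes> s c = \<zeta> x c \<otimes> s (act x c)" if "x \<in> carrier G" "c \<in> rcosets Z" for x c
    using that sc act by (simp add: \<zeta>_def m_assoc)
  have actmult: "act x (act y c) = act (x \<otimes> y) c"
    if x: "x \<in> carrier G" and y: "y \<in> carrier G" and c: "c \<in> rcosets Z" for x y c
  proof -
    have "(x \<otimes> y) \<otimes> s c = x \<otimes> (\<zeta> y c \<otimes> s (act y c))"
      using m_assoc[OF x y sc[OF c]] \<zeta>eq[OF y c] by simp
    also have "\<dots> = \<zeta> y c \<otimes> (x \<otimes> s (act y c))"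
      by (rule swap[OF \<zeta>Z[OF y c] x sc[OF act[OF y c]]])
    finally have "act (x \<otimes> y) c = Z #> (\<zeta> y c \<otimes> (x \<otimes> s (act y c)))"
      by (simp add: act_def)
    also have "\<dots> = act x (act y c)"
      unfolding act_def[of x] by (rule absorb[OF \<zeta>Z[OF y c] m_closed[OF x sc[OF act[OF y c]]]])
    finally show ?thesis by simp
  qed
  have act1: "act \<one> c = c" if c: "c \<in> rcosets Z" for c
  proof -
    obtain y where y: "y \<in> carrier G" "c = Z #> y"
      using c by (auto simp: RCOSETS_def)
    have "s c \<in> Z #> y" using s[OF c] y by simp
    then show ?thesis
      using y sc[OF c] repr_independence[OF _ y(1) Z] by (simp add: act_def)
  qed
  have bij: "bij_betw (act x) (rcosets Z) (rcosets Z)" if x: "x \<in> carrier G" for x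
    by (rule bij_betw_byWitness[where f' = "act (inv x)"])
       (use x act actmult act1 in \<open>auto\<close>)
  \<comment> \<open>The cocycle identity: \<open>y\<close> acts before \<open>x\<close>, and
    centrality of \<open>Z\<close> lets \<open>\<zeta> y c\<close> pass to the left of
    \<open>x\<close>.\<close>
  have \<zeta>mult: "\<zeta> (x \<otimes> y) c = \<zeta> x (act y c) \<otimes> \<zeta> y c"
    if x: "x \<in> carrier G" and y: "y \<in> carrier G" and c: "c \<in> rcosets Z" for x y c
  proof -
    have "(x \<otimes> y) \<otimes> s c = x \<otimes> (\<zeta> y c \<otimes> s (act y c))"
      using m_assoc[OF x y sc[OF c]] \<zeta>eq[OF y c] by simp
    also have "\<dots> = \<zeta> y c \<otimes> (x \<otimes> s (act y c))"
      by (rule swap[OF \<zeta>Z[OF y c] x sc[OF act[OF y c]]])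
    also have "x \<otimes> s (act y c) = \<zeta> x (act y c) \<otimes> s (act (x \<otimes> y) c)"
      using \<zeta>eq[OF x act[OF y c]] actmult[OF x y c] by simp
    also have "\<zeta> y c \<otimes> \<dots> = (\<zeta> x (act y c) \<otimes> \<zeta> y c) \<otimes> s (act (x \<otimes> y) c)"
      using swap[OF \<zeta>Z[OF y c]] \<zeta>Z[OF x act[OF y c]] \<zeta>Z[OF y c] Zc sc[OF act[OF m_closed[OF x y] c]]
      by (simp add: m_assoc subset_iff)
    finally have "(x \<otimes> y) \<otimes> s c = (\<zeta> x (act y c) \<otimes> \<zeta> y c) \<otimes> s (act (x \<otimes> y) c)" .
    then show ?thesis
      using \<zeta>Z[OF x act[OF y c]] \<zeta>Z[OF y c] Zc sc[OF act[OF m_closed[OF x y] c]]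
      unfolding \<zeta>_def[of "x \<otimes> y"] by (simp add: m_assoc subset_iff)
  qed
  \<comment> \<open>Multiplying over all cosets removes the dependence on \<open>c\<close>:
    \<open>act y\<close> permutes the cosets, so the shifted factor of the cocycle identity
    reindexes to \<open>\<tau> x\<close>.\<close>
  define \<tau> where "\<tau> x = finprod ?ZG (\<zeta> x) (rcosets Z)" for x
  have "\<tau> \<in> hom G ?ZG"
  proof (rule homI)
    fix x assume "x \<in> carrier G"
    then show "\<tau> x \<in> carrier ?ZG"
      unfolding \<tau>_def by (intro ZG.finprod_closed) (auto simp: \<zeta>Z)
  next
    fix x y assume x: "x \<in> carrier G" and y: "y \<in> carrier G"
    have "\<tau> (x \<otimes> y) = finprod ?ZG (\<lambda>c. \<zeta> x (act y c) \<otimes>\<^bsub>?ZG\<^esub> \<zeta> y c) (rcosets Z)"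
      unfolding \<tau>_def by (rule ZG.finprod_cong') (use x y \<zeta>mult \<zeta>Z act Z in \<open>auto simp: subgroup.m_closed\<close>)
    also have "\<dots> = finprod ?ZG (\<lambda>c. \<zeta> x (act y c)) (rcosets Z) \<otimes>\<^bsub>?ZG\<^esub> \<tau> y"
      unfolding \<tau>_def by (rule ZG.finprod_multf) (use x y \<zeta>Z act in auto)
    also have "finprod ?ZG (\<lambda>c. \<zeta> x (act y c)) (rcosets Z) = finprod ?ZG (\<zeta> x) (act y ` (rcosets Z))"
      by (rule ZG.finprod_reindex[symmetric]) (use bij[OF y] x \<zeta>Z act y in \<open>auto simp: bij_betw_def\<close>)
    also have "act y ` (rcosets Z) = rcosets Z" using bij[OF y] by (simp add: bij_betw_def)
    finally show "\<tau> (x \<otimes> y) = \<tau> x \<otimes>\<^bsub>?ZG\<^esub> \<tau> y" by (simp add: \<tau>_def)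
  qed
  moreover have "\<tau> z = z [^] card (rcosets Z)" if z: "z \<in> Z" for z
  proof -
    \<comment> \<open>Left multiplication by \<open>z \<in> Z\<close> fixes every coset, so each
      factor of \<open>\<tau> z\<close> is \<open>z\<close> itself.\<close>
    have "\<zeta> z c = z" if c: "c \<in> rcosets Z" for c
    proof -
      have "act z c = act \<one> c"
        using absorb[OF z sc[OF c]] sc[OF c] by (simp add: act_def)
      then show ?thesis
        using act1[OF c] sc[OF c] z Zc by (simp add: \<zeta>_def m_assoc subset_iff)
    qed
    then have "\<tau> z = finprod ?ZG (\<lambda>c. z) (rcosets Z)"
      unfolding \<tau>_def by (intro ZG.finprod_cong') (use z in auto)
    also have "\<dots> = z [^]\<^bsub>?ZG\<^esub> card (rcosets Z)"
      by (rule ZG.finprod_const) (use z in auto)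
    finally show ?thesis by (simp add: nat_pow_consistent[symmetric])
  qed
  ultimately show thesis using that by blast
qed

text \<open>On the centralizer of all torsion elements prime to \<open>\<sigma>\<close> these elements form a central
  subgroup of \<open>\<sigma>\<close>-index, on which the transfer is injective although it kills every
  \<open>\<sigma>\<close>-torsion element.\<close>
lemma pi_torsion_mult_closed:
  assumes fin: "finite (carrier G)"
    and comm: "\<And>x y. x \<in> pi_torsion \<sigma> \<Longrightarrow> y \<in> pi_torsion (- \<sigma>) \<Longrightarrow> x \<otimes> y = y \<otimes> x"
    and x: "x \<in> pi_torsion \<sigma>" and y: "y \<in> pi_torsion \<sigma>"
  shows "x \<otimes> y \<in> pi_torsion \<sigma>"
proof -
  define H where "H = {h \<in> carrier G. \<forall>z\<in>pi_torsion (- \<sigma>). h \<otimes> z = z \<otimes> h}"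
  define Z where "Z = H \<inter> pi_torsion (- \<sigma>)"
  let ?H = "G\<lparr>carrier := H\<rparr>"
  have tc: "pi_torsion \<tau> \<subseteq> carrier G" for \<tau> by (auto simp: pi_torsion_def)
  have H: "subgroup H G"
  proof (rule subgroupI)
    have "\<one> \<in> H" using tc by (auto simp: H_def subset_iff)
    then show "H \<noteq> {}" by blast
    show "inv a \<in> H" if "a \<in> H" for a
      using that tc by (auto simp: H_def subset_iff intro: commute_inv)
    show "a \<otimes> b \<in> H" if "a \<in> H" "b \<in> H" for a b
      using that tc by (auto simp: H_def subset_iff intro: commute_mult)
  qed (auto simp: H_def)
  interpret H: group ?H by (rule subgroup_imp_group[OF H])
  have finH: "finite H" using fin H finite_subset subgroup.subset by blast
  have central: "z \<otimes> h = h \<otimes> z" if "z \<in> Z" "h \<in> H" for z h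
    using that by (auto simp: Z_def H_def)
  \<comment> \<open>Closure under products holds because the elements of \<open>Z\<close> commute
    with each other; for all of \<open>pi_torsion (- \<sigma>)\<close> it is not known.\<close>
  have ZG: "subgroup Z G"
  proof (rule subgroupI)
    have "\<one> \<in> pi_torsion (- \<sigma>)" by (auto simp: pi_torsion_def intro!: exI[of _ 1])
    then show "Z \<noteq> {}" using subgroup.one_closed[OF H] by (auto simp: Z_def)
    show "inv a \<in> Z" if "a \<in> Z" for a
      using that H pi_torsion_inv by (auto simp: Z_def subgroup.m_inv_closed)
    show "a \<otimes> b \<in> Z" if "a \<in> Z" "b \<in> Z" for a b
      using that H pi_torsion_commuting_mult central[OF that(1), of b] by (auto simp: Z_def subgroup.m_closed)
  qed (use tc in \<open>auto simp: Z_def\<close>)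
  have ZH: "subgroup Z ?H"
    by (rule subgroup_incl[OF ZG H]) (auto simp: Z_def)
  define m where "m = card (rcosets\<^bsub>?H\<^esub> Z)"
  obtain \<tau> where \<tau>: "\<tau> \<in> hom ?H (?H\<lparr>carrier := Z\<rparr>)" and \<tau>Z: "\<And>z. z \<in> Z \<Longrightarrow> \<tau> z = z [^]\<^bsub>?H\<^esub> m"
    using H.central_transfer[OF _ ZH] finH central unfolding m_def by auto
  have \<tau>mult: "\<tau> (a \<otimes> b) = \<tau> a \<otimes> \<tau> b" if "a \<in> H" "b \<in> H" for a b
    using hom_mult[OF \<tau>] that by simp
  have \<tau>in: "\<tau> a \<in> Z" if "a \<in> H" for a
    using hom_in_carrier[OF \<tau>] that by simp
  have \<tau>1: "\<tau> \<one> = \<one>"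
    using \<tau>Z[of \<one>] subgroup.one_closed[OF ZG] by (simp add: nat_pow_consistent[symmetric])
  have \<tau>pow: "\<tau> (a [^] (n::nat)) = \<tau> a [^] n" if "a \<in> H" for a n
    by (induction n) (use that \<tau>1 \<tau>mult subgroup_nat_pow_closed[OF H] in auto)
  have lag: "m * card Z = card H"
    using H.lagrange[OF ZH] by (simp add: m_def order_def)
  have "card H > 0"
    using finH subgroup.one_closed[OF H] by (auto simp: card_gt_0_iff)
  \<comment> \<open>For a prime \<open>q\<close> outside \<open>\<sigma>\<close>, a Sylow
    \<open>q\<close>-subgroup \<open>Q\<close> of \<open>H\<close> consists of torsion prime to
    \<sigma> and so lies in \<open>Z\<close>. Then \<open>card Z\<close> carries the full
    \<open>q\<close>-part \<open>q ^ a\<close> of \<open>card H\<close>, which leaves no factor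
    \<open>q\<close> for the index \<open>m\<close>.\<close>
  have m: "pi_number \<sigma> m"
    unfolding pi_number_def
  proof (intro conjI allI impI)
    show "m > 0" using lag \<open>card H > 0\<close> by (metis gr0I mult_0)
    fix q assume q: "Factorial_Ring.prime q \<and> q dvd m"
    show "q \<in> \<sigma>"
    proof (rule ccontr)
      assume "q \<notin> \<sigma>"
      define a where "a = multiplicity q (card H)"
      obtain k where k: "card H = q ^ a * k"
        using multiplicity_dvd[of q "card H"] unfolding a_def by blast
      obtain Q where Q: "subgroup Q ?H" "card Q = q ^ a"
        using sylow_thm[of q ?H a k] q k finH H.is_group by (auto simp: order_def)
      have QH: "Q \<subseteq> H" using subgroup.subset[OF Q(1)] by simp
      have QG: "subgroup Q G" by (rule incl_subgroup[OF H Q(1)])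
      interpret Q: group "G\<lparr>carrier := Q\<rparr>" by (rule subgroup_imp_group[OF QG])
      have "w \<in> Z" if w: "w \<in> Q" for w
      proof -
        have "w [^] (q ^ a) = \<one>"
          using Q.pow_order_eq_1[of w] w Q(2) by (simp add: order_def nat_pow_consistent[symmetric])
        then have "w \<in> pi_torsion (- \<sigma>)"
          using pi_number_prime_power[of q "- \<sigma>" a] q \<open>q \<notin> \<sigma>\<close> w subgroup.mem_carrier[OF QG]
          by (auto simp: pi_torsion_def)
        with w QH show ?thesis by (auto simp: Z_def)
      qed
      then have "subgroup Q (G\<lparr>carrier := Z\<rparr>)"
        by (intro subgroup_incl[OF QG ZG]) auto
      then have "card Q dvd card Z"
        using group.lagrange[OF subgroup_imp_group[OF ZG], of Q] by (simp add: order_def) (metis dvd_triv_right)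
      then have "q ^ Suc a dvd card H"
        using mult_dvd_mono[of q m "q ^ a" "card Z"] q Q(2) lag by simp
      then show False
        using q \<open>card H > 0\<close> power_dvd_iff_le_multiplicity[of "card H" q "Suc a"]
        by (auto simp: a_def dest: prime_gt_1_nat)
    qed
  qed
  have \<sigma>H: "w \<in> H" if "w \<in> pi_torsion \<sigma>" for w
    using that comm tc by (auto simp: H_def)
  \<comment> \<open>The image is \<sigma>-torsion because \<open>\<tau>\<close> is a homomorphism,
    and torsion prime to \<sigma> because it lies in \<open>Z\<close>.\<close>
  have \<tau>\<sigma>: "\<tau> w = \<one>" if w: "w \<in> pi_torsion \<sigma>" for w
  proof (rule pi_torsion_disjoint)
    obtain n where "pi_number \<sigma> n" "w [^] n = \<one>" using w by (auto simp: pi_torsion_def)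
    then have "\<tau> w [^] n = \<one>" using \<tau>pow[OF \<sigma>H[OF w], of n] \<tau>1 by simp
    then show "\<tau> w \<in> pi_torsion \<sigma>"
      using \<tau>in[OF \<sigma>H[OF w]] \<open>pi_number \<sigma> n\<close> ZG subgroup.mem_carrier by (fastforce simp: pi_torsion_def)
    show "\<tau> w \<in> pi_torsion (- \<sigma>)"
      using \<tau>in[OF \<sigma>H[OF w]] by (simp add: Z_def)
  qed
  let ?w = "x \<otimes> y"
  have wH: "?w \<in> H" using x y \<sigma>H H by (simp add: subgroup.m_closed)
  then have wc: "?w \<in> carrier G" by (simp add: H_def)
  have "\<tau> ?w = \<one>" using x y \<sigma>H \<tau>\<sigma> \<tau>mult by simp
  have "order G > 0" using fin by (simp add: order_gt_0_iff_finite)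
  then obtain s t where st: "order G = s * t" "pi_number \<sigma> s" "pi_number (- \<sigma>) t"
    using pi_number_split by blast
  \<comment> \<open>\<open>s\<close> is the \<sigma>-part of the group order, so \<open>b\<close>
    has an exponent prime to \<sigma> and lies in \<open>Z\<close>. Evaluating
    \<open>\<tau> b\<close> both as \<open>b [^] m\<close> and as
    \<open>\<tau> ?w [^] s = \<one>\<close> shows that the \<sigma>-number \<open>m\<close> is an
    exponent as well, which forces \<open>b = \<one>\<close>.\<close>
  define b where "b = ?w [^] s"
  have "b [^] t = \<one>"
    using pow_order_eq_1[OF wc] wc by (simp add: b_def nat_pow_pow st(1))
  have bZ: "b \<in> Z"
    using wH wc st(3) \<open>b [^] t = \<one>\<close> subgroup_nat_pow_closed[OF H]
    by (auto simp: Z_def b_def pi_torsion_def)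
  have "b [^] m = \<tau> b" using \<tau>Z[OF bZ] by (simp add: nat_pow_consistent[symmetric])
  also have "\<dots> = \<one>" unfolding b_def using \<tau>pow[OF wH] \<open>\<tau> ?w = \<one>\<close> by simp
  finally have "b \<in> pi_torsion \<sigma>" using m bZ ZG subgroup.mem_carrier by (fastforce simp: pi_torsion_def)
  then have "b = \<one>" using bZ pi_torsion_disjoint by (auto simp: Z_def)
  then show ?thesis using st(2) wc by (auto simp: pi_torsion_def b_def)
qed

end


section \<open>Local products\<close>

locale local_product =
  fixes I :: "'i set" and Gs :: "'i \<Rightarrow> 'a monoid" and Xs :: "'i \<Rightarrow> 'a topology" and C :: "'i \<Rightarrow> 'a set"
  assumes top_group: "\<And>j. j \<in> I \<Longrightarrow> topological_group (Gs j) (Xs j)"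
    and sub: "\<And>j. j \<in> I \<Longrightarrow> subgroup (C j) (Gs j)"
begin

abbreviation "PG \<equiv> product_group I Gs"
abbreviation "PT \<equiv> product_topology (\<lambda>j. subtopology (Xs j) (C j)) I"
abbreviation "LPC \<equiv> loc_prod_carrier I Gs C"
abbreviation "LPT \<equiv> loc_prod_topology I Gs Xs C"

lemma groups: "j \<in> I \<Longrightarrow> group (Gs j)"
  using top_group by (simp add: topological_group_def)

sublocale PG: group PG
  by (rule product_group) (rule groups)

lemma PiE_subgroup: "subgroup (Pi\<^sub>E I C) PG"
  using PiE_subgroup_product_group[of I Gs C] groups sub by blast

lemma topspace_PT: "topspace PT = Pi\<^sub>E I C"
proof -
  have "topspace (subtopology (Xs j) (C j)) = C j" if "j \<in> I" for j
    using top_group[OF that] subgroup.subset[OF sub[OF that]] by (auto simp: topological_group_def)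
  then show ?thesis unfolding topspace_product_topology by (rule PiE_cong)
qed

lemma LPC_carrier: "x \<in> LPC \<Longrightarrow> x \<in> carrier PG"
  by (simp add: loc_prod_carrier_def)

lemma LPC_mult:
  assumes x: "x \<in> LPC" and u: "u \<in> Pi\<^sub>E I C"
  shows "x \<otimes>\<^bsub>PG\<^esub> u \<in> LPC"
proof -
  have c: "x \<otimes>\<^bsub>PG\<^esub> u \<in> carrier PG"
    by (rule PG.m_closed[OF LPC_carrier[OF x] subgroup.mem_carrier[OF PiE_subgroup u]])
  have "{j \<in> I. (x \<otimes>\<^bsub>PG\<^esub> u) j \<notin> C j} \<subseteq> {j \<in> I. x j \<notin> C j}"
    using u subgroup.m_closed[OF sub] by auto
  moreover have "finite {j \<in> I. x j \<notin> C j}" using x by (simp add: loc_prod_carrier_def)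
  ultimately have "finite {j \<in> I. (x \<otimes>\<^bsub>PG\<^esub> u) j \<notin> C j}" by (rule finite_subset)
  with c show ?thesis unfolding loc_prod_carrier_def carrier_product_group by blast
qed

lemma continuous_translate_PT:
  assumes a: "a \<in> Pi\<^sub>E I C"
  shows "continuous_map PT PT (\<lambda>u. a \<otimes>\<^bsub>PG\<^esub> u)"
  unfolding continuous_map_componentwise
proof (intro conjI ballI)
  show "(\<lambda>u. a \<otimes>\<^bsub>PG\<^esub> u) ` topspace PT \<subseteq> extensional I" by auto
  fix k assume k: "k \<in> I"
  have tg: "topological_group (Gs k) (Xs k)" by (rule top_group[OF k])
  have pk: "continuous_map PT (subtopology (Xs k) (C k)) (\<lambda>u. u k)"
    by (rule continuous_map_product_projection[OF k])
  have ak: "a k \<in> C k" using a k by auto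
  then have "a k \<in> topspace (Xs k)"
    using tg subgroup.mem_carrier[OF sub[OF k]] by (simp add: topological_group_def)
  then have "continuous_map PT (prod_topology (Xs k) (Xs k)) (\<lambda>u. (a k, u k))"
    using continuous_map_into_fulltopology[OF pk] by (intro continuous_map_pairedI) auto
  then have "continuous_map PT (Xs k) ((\<lambda>(x, y). x \<otimes>\<^bsub>Gs k\<^esub> y) \<circ> (\<lambda>u. (a k, u k)))"
    using tg by (auto intro: continuous_map_compose simp: topological_group_def)
  then have "continuous_map PT (subtopology (Xs k) (C k)) (\<lambda>u. a k \<otimes>\<^bsub>Gs k\<^esub> u k)"
    using ak k subgroup.m_closed[OF sub[OF k]] unfolding continuous_map_in_subtopology topspace_PT
    by (auto simp: o_def)
  then show "continuous_map PT (subtopology (Xs k) (C k)) (\<lambda>u. (a \<otimes>\<^bsub>PG\<^esub> u) k)"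
    using k by simp
qed

lemma open_translate_PT:
  assumes a: "a \<in> Pi\<^sub>E I C" and S: "openin PT S"
  shows "openin PT {u \<in> Pi\<^sub>E I C. a \<otimes>\<^bsub>PG\<^esub> u \<in> S}"
  using openin_continuous_map_preimage[OF continuous_translate_PT[OF a] S] unfolding topspace_PT .

text \<open>The predicate inside \<open>loc_prod_topology\<close>, named so that
  \<open>istopology_lopen\<close> can turn \<open>openin\<close> of that topology into it.\<close>

definition lopen :: "('i \<Rightarrow> 'a) set \<Rightarrow> bool" where
  "lopen W \<longleftrightarrow> W \<subseteq> LPC \<and> (\<forall>x\<in>W. openin PT {u \<in> Pi\<^sub>E I C. x \<otimes>\<^bsub>PG\<^esub> u \<in> W})"

text \<open>The definition tests a set only at its own points, but for unions the test is also
  needed at points outside a given member. Wherever x u falls into \<open>W\<close>, the test at x u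
  is carried back by the inverse of u.\<close>

lemma lopen_translate:
  assumes W: "lopen W" and x: "x \<in> LPC"
  shows "openin PT {u \<in> Pi\<^sub>E I C. x \<otimes>\<^bsub>PG\<^esub> u \<in> W}"
proof (subst openin_subopen, intro ballI)
  note PC = subgroup.mem_carrier[OF PiE_subgroup]
  have xc: "x \<in> carrier PG" using x by (rule LPC_carrier)
  fix u assume "u \<in> {u \<in> Pi\<^sub>E I C. x \<otimes>\<^bsub>PG\<^esub> u \<in> W}"
  then have u: "u \<in> Pi\<^sub>E I C" "x \<otimes>\<^bsub>PG\<^esub> u \<in> W" by auto
  let ?u' = "inv\<^bsub>PG\<^esub> u"
  let ?S = "{v \<in> Pi\<^sub>E I C. (x \<otimes>\<^bsub>PG\<^esub> u) \<otimes>\<^bsub>PG\<^esub> v \<in> W}"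
  let ?O = "{v \<in> Pi\<^sub>E I C. ?u' \<otimes>\<^bsub>PG\<^esub> v \<in> ?S}"
  have u': "?u' \<in> Pi\<^sub>E I C" by (rule subgroup.m_inv_closed[OF PiE_subgroup u(1)])
  have "openin PT ?S" using W u(2) unfolding lopen_def by blast
  then have "openin PT ?O" by (rule open_translate_PT[OF u'])
  moreover have "u \<in> ?O"
  proof -
    have "?u' \<otimes>\<^bsub>PG\<^esub> u = \<one>\<^bsub>PG\<^esub>" by (rule PG.l_inv[OF PC[OF u(1)]])
    moreover have "(x \<otimes>\<^bsub>PG\<^esub> u) \<otimes>\<^bsub>PG\<^esub> \<one>\<^bsub>PG\<^esub> = x \<otimes>\<^bsub>PG\<^esub> u"
      by (rule PG.r_one[OF PG.m_closed[OF xc PC[OF u(1)]]])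
    ultimately show ?thesis using u subgroup.one_closed[OF PiE_subgroup]
      by (simp del: mult_product_group one_product_group inv_product_group)
  qed
  moreover have "?O \<subseteq> {u \<in> Pi\<^sub>E I C. x \<otimes>\<^bsub>PG\<^esub> u \<in> W}"
  proof
    fix v assume v: "v \<in> ?O"
    then have vc: "v \<in> carrier PG" using PC by blast
    have "(x \<otimes>\<^bsub>PG\<^esub> u) \<otimes>\<^bsub>PG\<^esub> (?u' \<otimes>\<^bsub>PG\<^esub> v) = x \<otimes>\<^bsub>PG\<^esub> (u \<otimes>\<^bsub>PG\<^esub> (?u' \<otimes>\<^bsub>PG\<^esub> v))"
      by (rule PG.m_assoc[OF xc PC[OF u(1)] PG.m_closed[OF PC[OF u'] vc]])
    also have "u \<otimes>\<^bsub>PG\<^esub> (?u' \<otimes>\<^bsub>PG\<^esub> v) = (u \<otimes>\<^bsub>PG\<^esub> ?u') \<otimes>\<^bsub>PG\<^esub> v"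
      by (rule PG.m_assoc[symmetric, OF PC[OF u(1)] PC[OF u'] vc])
    also have "u \<otimes>\<^bsub>PG\<^esub> ?u' = \<one>\<^bsub>PG\<^esub>" by (rule PG.r_inv[OF PC[OF u(1)]])
    also have "\<one>\<^bsub>PG\<^esub> \<otimes>\<^bsub>PG\<^esub> v = v" by (rule PG.l_one[OF vc])
    finally have eq: "(x \<otimes>\<^bsub>PG\<^esub> u) \<otimes>\<^bsub>PG\<^esub> (?u' \<otimes>\<^bsub>PG\<^esub> v) = x \<otimes>\<^bsub>PG\<^esub> v" .
    have "(x \<otimes>\<^bsub>PG\<^esub> u) \<otimes>\<^bsub>PG\<^esub> (?u' \<otimes>\<^bsub>PG\<^esub> v) \<in> W" using v by blast
    then show "v \<in> {u \<in> Pi\<^sub>E I C. x \<otimes>\<^bsub>PG\<^esub> u \<in> W}" using v unfolding eq by blast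
  qed
  ultimately show "\<exists>S. openin PT S \<and> u \<in> S \<and> S \<subseteq> {u \<in> Pi\<^sub>E I C. x \<otimes>\<^bsub>PG\<^esub> u \<in> W}" by blast
qed

lemma istopology_lopen: "istopology lopen"
  unfolding istopology_def
proof (intro conjI allI impI)
  fix S W assume S: "lopen S" and W: "lopen W"
  have "openin PT {u \<in> Pi\<^sub>E I C. x \<otimes>\<^bsub>PG\<^esub> u \<in> S \<inter> W}" if "x \<in> S \<inter> W" for x
  proof -
    have "{u \<in> Pi\<^sub>E I C. x \<otimes>\<^bsub>PG\<^esub> u \<in> S \<inter> W} =
      {u \<in> Pi\<^sub>E I C. x \<otimes>\<^bsub>PG\<^esub> u \<in> S} \<inter> {u \<in> Pi\<^sub>E I C. x \<otimes>\<^bsub>PG\<^esub> u \<in> W}" by blast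
    moreover have "openin PT {u \<in> Pi\<^sub>E I C. x \<otimes>\<^bsub>PG\<^esub> u \<in> S}" "openin PT {u \<in> Pi\<^sub>E I C. x \<otimes>\<^bsub>PG\<^esub> u \<in> W}"
      using that S W unfolding lopen_def by blast+
    ultimately show ?thesis by (simp only: openin_Int)
  qed
  then show "lopen (S \<inter> W)" using S unfolding lopen_def by blast
next
  fix \<K> assume K: "\<forall>K\<in>\<K>. lopen K"
  have sub: "\<Union>\<K> \<subseteq> LPC" using K unfolding lopen_def by blast
  have "openin PT {u \<in> Pi\<^sub>E I C. x \<otimes>\<^bsub>PG\<^esub> u \<in> \<Union>\<K>}" if "x \<in> \<Union>\<K>" for x
  proof -
    have "{u \<in> Pi\<^sub>E I C. x \<otimes>\<^bsub>PG\<^esub> u \<in> \<Union>\<K>} = (\<Union>K\<in>\<K>. {u \<in> Pi\<^sub>E I C. x \<otimes>\<^bsub>PG\<^esub> u \<in> K})" by blast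
    moreover have "openin PT (\<Union>K\<in>\<K>. {u \<in> Pi\<^sub>E I C. x \<otimes>\<^bsub>PG\<^esub> u \<in> K})"
      using K lopen_translate sub that by (intro openin_Union) blast
    ultimately show ?thesis by (simp only:)
  qed
  with sub show "lopen (\<Union>\<K>)" unfolding lopen_def by blast
qed

lemma openin_LPT: "openin LPT = lopen"
proof -
  have "LPT = topology lopen"
    unfolding loc_prod_topology_def lopen_def[abs_def] ..
  then show ?thesis using topology_inverse'[OF istopology_lopen] by simp
qed

lemma topspace_LPT: "topspace LPT = LPC"
proof -
  have "openin PT {u \<in> Pi\<^sub>E I C. x \<otimes>\<^bsub>PG\<^esub> u \<in> LPC}" if "x \<in> LPC" for x
  proof -
    have "{u \<in> Pi\<^sub>E I C. x \<otimes>\<^bsub>PG\<^esub> u \<in> LPC} = topspace PT"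
      using LPC_mult[OF that] unfolding topspace_PT by blast
    then show ?thesis by (metis openin_topspace)
  qed
  then have "lopen LPC" unfolding lopen_def by blast
  then have "LPC \<subseteq> topspace LPT" using openin_subset[of LPT LPC] openin_LPT by simp
  moreover have "topspace LPT \<subseteq> LPC" using openin_topspace[of LPT] unfolding openin_LPT lopen_def by blast
  ultimately show ?thesis by blast
qed

text \<open>Provides the open sets with which open maps into the local product are recognised. At a
  point y = x s the factor x cancels, and what remains is the preimage of \<open>S\<close> under
  translation by s.\<close>

lemma open_coset_LPT:
  assumes x: "x \<in> LPC" and S: "openin PT S"
  shows "openin LPT ((\<lambda>u. x \<otimes>\<^bsub>PG\<^esub> u) ` S)"
  unfolding openin_LPT lopen_def
proof (intro conjI ballI)
  note PC = subgroup.mem_carrier[OF PiE_subgroup]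
  have SC: "S \<subseteq> Pi\<^sub>E I C" using openin_subset[OF S] unfolding topspace_PT .
  have xc: "x \<in> carrier PG" using x by (rule LPC_carrier)
  show "(\<lambda>u. x \<otimes>\<^bsub>PG\<^esub> u) ` S \<subseteq> LPC" using LPC_mult[OF x] SC by blast
  fix y assume "y \<in> (\<lambda>u. x \<otimes>\<^bsub>PG\<^esub> u) ` S"
  then obtain s where s: "s \<in> S" "y = x \<otimes>\<^bsub>PG\<^esub> s" by blast
  have sC: "s \<in> Pi\<^sub>E I C" using s SC by blast
  have "y \<otimes>\<^bsub>PG\<^esub> u \<in> (\<lambda>u. x \<otimes>\<^bsub>PG\<^esub> u) ` S \<longleftrightarrow> s \<otimes>\<^bsub>PG\<^esub> u \<in> S" if u: "u \<in> Pi\<^sub>E I C" for u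
  proof -
    have eq: "y \<otimes>\<^bsub>PG\<^esub> u = x \<otimes>\<^bsub>PG\<^esub> (s \<otimes>\<^bsub>PG\<^esub> u)"
      unfolding s(2) by (rule PG.m_assoc[OF xc PC[OF sC] PC[OF u]])
    have su: "s \<otimes>\<^bsub>PG\<^esub> u \<in> carrier PG" by (rule PG.m_closed[OF PC[OF sC] PC[OF u]])
    show ?thesis
    proof
      assume "y \<otimes>\<^bsub>PG\<^esub> u \<in> (\<lambda>u. x \<otimes>\<^bsub>PG\<^esub> u) ` S"
      then obtain w where w: "w \<in> S" "x \<otimes>\<^bsub>PG\<^esub> (s \<otimes>\<^bsub>PG\<^esub> u) = x \<otimes>\<^bsub>PG\<^esub> w" unfolding eq by blast
      then have "s \<otimes>\<^bsub>PG\<^esub> u = w" using PG.l_cancel[OF w(2) su _ xc] SC PC by blast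
      then show "s \<otimes>\<^bsub>PG\<^esub> u \<in> S" using w(1) by simp
    qed (unfold eq, blast)
  qed
  then have "{u \<in> Pi\<^sub>E I C. y \<otimes>\<^bsub>PG\<^esub> u \<in> (\<lambda>u. x \<otimes>\<^bsub>PG\<^esub> u) ` S} = {u \<in> Pi\<^sub>E I C. s \<otimes>\<^bsub>PG\<^esub> u \<in> S}" by blast
  then show "openin PT {u \<in> Pi\<^sub>E I C. y \<otimes>\<^bsub>PG\<^esub> u \<in> (\<lambda>u. x \<otimes>\<^bsub>PG\<^esub> u) ` S}"
    using open_translate_PT[OF sC S] by (simp only:)
qed

end


section \<open>Open subgroups of compactly ruled groups\<close>

locale ruled_group = group G for G :: "'a monoid" (structure) +
  fixes T :: "'a topology"
  assumes topspace_eq: "topspace T = carrier G"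
    and continuous_mult: "continuous_map (prod_topology T T) T (\<lambda>(x, y). x \<otimes> y)"
    and continuous_inv: "continuous_map T T (m_inv G)"
    and Hausdorff: "Hausdorff_space T"
    and totally_disconnected: "totally_disconnected_space T"
    and ruled: "compactly_ruled G T"
begin

abbreviation "compact_open \<equiv> compact_open_subgroup G T"

definition open_subgroup :: "'a set \<Rightarrow> bool" where
  "open_subgroup V \<longleftrightarrow> subgroup V G \<and> openin T V"

lemma compact_open_imp_open_subgroup: "compact_open U \<Longrightarrow> open_subgroup U"
  by (simp add: open_subgroup_def compact_open_subgroup_def)

lemma open_subgroup_subgroup: "open_subgroup V \<Longrightarrow> subgroup V G"
  by (simp add: open_subgroup_def)

lemma open_subgroup_Int: "open_subgroup U \<Longrightarrow> open_subgroup V \<Longrightarrow> open_subgroup (U \<inter> V)"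
  by (simp add: open_subgroup_def subgroups_Inter_pair openin_Int)

lemma open_subgroup_carrier: "open_subgroup (carrier G)"
  using subgroup_self topspace_eq openin_topspace[of T] by (simp add: open_subgroup_def)

lemma compact_open_finite_superset:
  assumes "finite F" "F \<subseteq> carrier G" "compact_open U"
  obtains W where "compact_open W" "U \<subseteq> W" "F \<subseteq> W"
proof -
  have "\<exists>W. compact_open W \<and> U \<subseteq> W \<and> F \<subseteq> W"
    using assms(1,2)
  proof (induction F)
    case empty
    then show ?case using assms(3) by blast
  next
    case (insert x F)
    then obtain W where W: "compact_open W" "U \<subseteq> W" "F \<subseteq> W" by auto
    have "x \<in> carrier G" using insert.prems by simp
    then obtain V where V: "compact_open V" "x \<in> V"
      using ruled unfolding compactly_ruled_def by blast
    then obtain W' where "compact_open W'" "W \<union> V \<subseteq> W'"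
      using ruled W(1) unfolding compactly_ruled_def by blast
    with W V show ?case by blast
  qed
  then show thesis using that by blast
qed

lemma compact_open_exists: obtains U where "compact_open U"
proof -
  have "\<one> \<in> \<Union>{U. compact_open U}"
    using ruled one_closed unfolding compactly_ruled_def by metis
  then show thesis using that by blast
qed

lemma compact_open_superset:
  assumes "finite F" "F \<subseteq> carrier G"
  obtains W where "compact_open W" "F \<subseteq> W"
proof -
  obtain U where "compact_open U" using compact_open_exists .
  then show thesis using compact_open_finite_superset[OF assms] that by blast
qed

section \<open>Translations and open subgroups\<close>

lemma continuous_map_mult:
  assumes "continuous_map Y T f" "continuous_map Y T g"
  shows "continuous_map Y T (\<lambda>x. f x \<otimes> g x)"
  using continuous_map_compose[OF continuous_map_pairedI[OF assms] continuous_mult]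
  by (simp add: o_def)

lemma continuous_map_translate:
  assumes "a \<in> carrier G"
  shows "continuous_map T T (\<lambda>x. a \<otimes> x)" "continuous_map T T (\<lambda>x. x \<otimes> a)"
  using assms by (auto intro!: continuous_map_mult simp: topspace_eq)

lemma open_subset_carrier: "openin T S \<Longrightarrow> S \<subseteq> carrier G"
  using openin_subset topspace_eq by metis

lemma open_left_translate:
  assumes a: "a \<in> carrier G" and S: "openin T S"
  shows "openin T ((\<lambda>x. a \<otimes> x) ` S)"
proof -
  have "(\<lambda>x. a \<otimes> x) ` S = {x \<in> topspace T. inv a \<otimes> x \<in> S}"
  proof safe
    fix x assume "x \<in> topspace T" "inv a \<otimes> x \<in> S"
    then show "x \<in> (\<lambda>x. a \<otimes> x) ` S"
      using a by (intro image_eqI[of _ _ "inv a \<otimes> x"]) (auto simp: topspace_eq m_assoc[symmetric])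
  qed (use a open_subset_carrier[OF S] in \<open>auto simp: topspace_eq m_assoc[symmetric] subset_iff\<close>)
  then show ?thesis
    using openin_continuous_map_preimage[OF continuous_map_translate(1)[of "inv a"] S] a by simp
qed

lemma open_right_translate:
  assumes a: "a \<in> carrier G" and S: "openin T S"
  shows "openin T ((\<lambda>x. x \<otimes> a) ` S)"
proof -
  have "(\<lambda>x. x \<otimes> a) ` S = {x \<in> topspace T. x \<otimes> inv a \<in> S}"
  proof safe
    fix x assume "x \<in> topspace T" "x \<otimes> inv a \<in> S"
    then show "x \<in> (\<lambda>x. x \<otimes> a) ` S"
      using a by (intro image_eqI[of _ _ "x \<otimes> inv a"]) (auto simp: topspace_eq m_assoc)
  qed (use a open_subset_carrier[OF S] in \<open>auto simp: topspace_eq m_assoc subset_iff\<close>)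
  then show ?thesis
    using openin_continuous_map_preimage[OF continuous_map_translate(2)[of "inv a"] S] a by simp
qed

lemma self_in_left_coset: "open_subgroup V \<Longrightarrow> x \<in> carrier G \<Longrightarrow> x \<in> (\<lambda>v. x \<otimes> v) ` V"
  using subgroup.one_closed[OF open_subgroup_subgroup] by (intro image_eqI[of _ _ \<one>]) auto

lemma open_subgroup_closed: assumes V: "open_subgroup V" shows "closedin T V"
proof -
  have "openin T (carrier G - V)"
  proof (subst openin_subopen, intro ballI)
    fix x assume x: "x \<in> carrier G - V"
    have sV: "subgroup V G" and oV: "openin T V" using V by (auto simp: open_subgroup_def)
    have "(\<lambda>v. x \<otimes> v) ` V \<subseteq> carrier G - V"
    proof safe
      fix v assume v: "v \<in> V"
      then show "x \<otimes> v \<in> carrier G" using x sV subgroup.mem_carrier by fastforce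
      assume "x \<otimes> v \<in> V"
      then have "x \<otimes> v \<otimes> inv v \<in> V" using v sV by (simp add: subgroup.m_closed subgroup.m_inv_closed)
      then show False using x v subgroup.mem_carrier[OF sV v] by (simp add: m_assoc)
    qed
    then show "\<exists>S. openin T S \<and> x \<in> S \<and> S \<subseteq> carrier G - V"
      using open_left_translate[OF _ oV, of x] x self_in_left_coset[OF V, of x]
      by (intro exI[of _ "(\<lambda>v. x \<otimes> v) ` V"]) auto
  qed
  then show ?thesis
    using V subgroup.subset[OF open_subgroup_subgroup[OF V]] by (simp add: closedin_def topspace_eq)
qed

lemma open_subgroupI:
  assumes N: "subgroup N G" and W: "openin T W" "\<one> \<in> W" "W \<subseteq> N"
  shows "open_subgroup N"
proof -
  have "\<exists>S. openin T S \<and> x \<in> S \<and> S \<subseteq> N" if x: "x \<in> N" for x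
  proof (intro exI conjI)
    have xc: "x \<in> carrier G" using N x subgroup.mem_carrier by fast
    show "openin T ((\<lambda>v. x \<otimes> v) ` W)" using open_left_translate[OF xc W(1)] .
    show "x \<in> (\<lambda>v. x \<otimes> v) ` W" using W(2) xc by (intro image_eqI[of _ _ \<one>]) auto
    show "(\<lambda>v. x \<otimes> v) ` W \<subseteq> N" using W(3) x N by (auto simp: subgroup.m_closed subset_iff)
  qed
  then have "openin T N" by (subst openin_subopen) blast
  with N show ?thesis by (simp add: open_subgroup_def)
qed

section \<open>Small open normal subgroups and finite quotients\<close>

text \<open>In a compact Hausdorff space, two closed sets that no connected set joins are separated
  by a clopen set. Total disconnectedness rules out connected sets joining \<one> to
  \<open>U - W\<close>, and since \<open>U\<close> is open and closed the clopen piece of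
  \<open>U\<close> is clopen in the whole group.\<close>

lemma clopen_neighbourhood:
  assumes U: "compact_open U" and W: "openin T W" "\<one> \<in> W"
  obtains K where "openin T K" "closedin T K" "\<one> \<in> K" "K \<subseteq> W \<inter> U"
proof -
  let ?X = "subtopology T U"
  have U': "subgroup U G" "compactin T U" "openin T U" using U by (auto simp: compact_open_subgroup_def)
  have Uc: "U \<subseteq> carrier G" using U' subgroup.subset by blast
  have tX: "topspace ?X = U" using Uc by (auto simp: topspace_eq)
  have "separated_between ?X {\<one>} (U - W)"
  proof (rule cut_wire_fence_theorem)
    show "compact_space ?X" using U'(2) compact_space_subtopology by blast
    show H: "Hausdorff_space ?X" using Hausdorff Hausdorff_space_subtopology by blast
    show "closedin ?X {\<one>}"
      using subgroup.one_closed[OF U'(1)] tX H by (simp add: closedin_Hausdorff_singleton)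
    show "closedin ?X (U - W)"
      using openin_subtopology_Int2[OF W(1), of U] tX by (simp add: closedin_def Diff_Diff_Int)
    show "disjnt C {\<one>} \<or> disjnt C (U - W)" if "connectedin ?X C" for C
    proof -
      have "connectedin T C" using that by (simp add: connectedin_subtopology)
      then obtain z where "C \<subseteq> {z}" using totally_disconnected unfolding totally_disconnected_space_def by blast
      then show ?thesis using W(2) by (auto simp: disjnt_def)
    qed
  qed
  then obtain K L where KL: "openin ?X K" "openin ?X L" "K \<union> L = U" "disjnt K L" "\<one> \<in> K" "U - W \<subseteq> L"
    unfolding separated_between_def tX by auto
  have "K = U - L" using KL(3,4) by (auto simp: disjnt_def)
  have oK: "openin T K" "openin T L" using KL(1,2) openin_trans_full[OF _ U'(3)] by auto
  have "closedin T U" using compactin_imp_closedin[OF Hausdorff U'(2)] .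
  then have "closedin T K" using \<open>K = U - L\<close> oK(2) by (simp add: closedin_diff)
  moreover have "K \<subseteq> W \<inter> U" using KL by (auto simp: disjnt_def)
  ultimately show thesis using that KL(5) oK(1) by blast
qed

text \<open>For a clopen neighbourhood \<open>K\<close> of the identity in \<open>U\<close>, the elements that may be inserted into any
  product without changing its membership in \<open>K\<close> form a normal subgroup contained in \<open>K\<close>; the
  tube lemma makes it open.\<close>
lemma normal_neighbourhood:
  assumes U: "compact_open U" and W: "openin T W" "\<one> \<in> W"
  obtains N where "open_subgroup N" "N \<subseteq> W" "N \<lhd> (G\<lparr>carrier := U\<rparr>)"
proof -
  obtain K where K: "openin T K" "closedin T K" "\<one> \<in> K" "K \<subseteq> W \<inter> U"
    using clopen_neighbourhood[OF assms] .
  have U': "subgroup U G" "compactin T U" "openin T U" using U by (auto simp: compact_open_subgroup_def)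
  have Uc: "U \<subseteq> carrier G" using U' subgroup.subset by blast
  note Um = subgroup.m_closed[OF U'(1)] subgroup.m_inv_closed[OF U'(1)] subgroup.one_closed[OF U'(1)]
  define N where "N = {n \<in> U. \<forall>a\<in>U. \<forall>b\<in>U. a \<otimes> n \<otimes> b \<in> K \<longleftrightarrow> a \<otimes> b \<in> K}"
  have NU: "n \<in> carrier G" if "n \<in> N" for n using that Uc by (auto simp: N_def)
  have Nsub: "subgroup N G"
  proof (rule subgroupI)
    have "\<one> \<in> N" using Um Uc by (auto simp: N_def subset_iff)
    then show "N \<noteq> {}" by blast
    show "inv n \<in> N" if n: "n \<in> N" for n
    proof -
      have "a \<otimes> inv n \<otimes> b \<in> K \<longleftrightarrow> a \<otimes> b \<in> K" if a: "a \<in> U" and b: "b \<in> U" for a b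
      proof -
        have "(a \<otimes> inv n) \<otimes> n \<otimes> b \<in> K \<longleftrightarrow> (a \<otimes> inv n) \<otimes> b \<in> K"
          using n a b Um unfolding N_def by blast
        then show ?thesis using a b NU[OF n] Uc by (simp add: m_assoc subset_iff)
      qed
      then show ?thesis using n Um by (auto simp: N_def)
    qed
    show "n \<otimes> n' \<in> N" if n: "n \<in> N" "n' \<in> N" for n n'
    proof -
      have "a \<otimes> (n \<otimes> n') \<otimes> b \<in> K \<longleftrightarrow> a \<otimes> b \<in> K" if a: "a \<in> U" and b: "b \<in> U" for a b
      proof -
        have "(a \<otimes> n) \<otimes> n' \<otimes> b \<in> K \<longleftrightarrow> a \<otimes> n \<otimes> b \<in> K"
          using n a b Um unfolding N_def by blast
        moreover have "a \<otimes> n \<otimes> b \<in> K \<longleftrightarrow> a \<otimes> b \<in> K"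
          using n a b unfolding N_def by blast
        ultimately show ?thesis using a b NU[OF n(1)] NU[OF n(2)] Uc by (simp add: m_assoc subset_iff)
      qed
      then show ?thesis using n Um by (auto simp: N_def)
    qed
  qed (use NU in blast)
  \<comment> \<open>Insert \<open>n\<close> between \<open>a \<otimes> u\<close> and
    \<open>inv u \<otimes> b\<close>, whose product is still \<open>a \<otimes> b\<close>.\<close>
  have conj: "u \<otimes> n \<otimes> inv u \<in> N" if u: "u \<in> U" and n: "n \<in> N" for u n
  proof -
    have "a \<otimes> (u \<otimes> n \<otimes> inv u) \<otimes> b \<in> K \<longleftrightarrow> a \<otimes> b \<in> K" if a: "a \<in> U" and b: "b \<in> U" for a b
    proof -
      have "(a \<otimes> u) \<otimes> n \<otimes> (inv u \<otimes> b) \<in> K \<longleftrightarrow> (a \<otimes> u) \<otimes> (inv u \<otimes> b) \<in> K"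
        using n u a b Um unfolding N_def by blast
      moreover have "(a \<otimes> u) \<otimes> (inv u \<otimes> b) = a \<otimes> b"
      proof -
        have "u \<otimes> (inv u \<otimes> b) = b" using b u Uc by (simp add: m_assoc[symmetric] subset_iff)
        then show ?thesis using a b u Uc by (simp add: m_assoc subset_iff)
      qed
      ultimately show ?thesis using a b u NU[OF n] Uc by (simp add: m_assoc subset_iff)
    qed
    then show ?thesis using n u Um by (auto simp: N_def)
  qed
  have NK: "N \<subseteq> K"
  proof
    fix n assume n: "n \<in> N"
    then have "\<one> \<otimes> n \<otimes> \<one> \<in> K \<longleftrightarrow> \<one> \<otimes> \<one> \<in> K" using Um(3) unfolding N_def by blast
    then show "n \<in> K" using K(3) NU[OF n] by simp
  qed
  let ?P = "prod_topology (prod_topology T T) T"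
  let ?f = "\<lambda>w. fst (fst w) \<otimes> snd w \<otimes> snd (fst w)"
  let ?g = "\<lambda>w. fst (fst w) \<otimes> snd (fst w)"
  have c1: "continuous_map ?P T (\<lambda>w. fst (fst w))" "continuous_map ?P T (\<lambda>w. snd (fst w))"
    "continuous_map ?P T (\<lambda>w. snd w)"
    using continuous_map_compose[OF continuous_map_fst[of "prod_topology T T" T] continuous_map_fst]
      continuous_map_compose[OF continuous_map_fst[of "prod_topology T T" T] continuous_map_snd]
      continuous_map_snd[of "prod_topology T T" T]
    by (auto simp: o_def)
  have cf: "continuous_map ?P T ?f" "continuous_map ?P T ?g"
    using c1 by (auto intro!: continuous_map_mult)
  \<comment> \<open>The triples on which the two memberships agree. This set is open because
    \<open>K\<close> is open and closed, and for \<open>n = \<one>\<close> the agreement is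
    trivial.\<close>
  let ?D = "{w \<in> topspace ?P. ?f w \<in> K} \<inter> {w \<in> topspace ?P. ?g w \<in> K} \<union>
    {w \<in> topspace ?P. ?f w \<in> topspace T - K} \<inter> {w \<in> topspace ?P. ?g w \<in> topspace T - K}"
  have oD: "openin ?P ?D"
    using K(1,2) by (intro openin_Un openin_Int openin_continuous_map_preimage[OF cf(1)] openin_continuous_map_preimage[OF cf(2)]) auto
  have subD: "(U \<times> U) \<times> {\<one>} \<subseteq> ?D"
    using Uc Um by (auto simp: topspace_eq subset_iff)
  have cU: "compactin (prod_topology T T) (U \<times> U)"
    using U'(2) by (simp add: compactin_Times)
  have c1: "compactin T {\<one>}" by (simp add: topspace_eq)
  obtain A B where "openin (prod_topology T T) A" and AB: "openin T B" "U \<times> U \<subseteq> A" "{\<one>} \<subseteq> B" "A \<times> B \<subseteq> ?D"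
    by (rule Wallace_theorem_prod_topology[OF cU c1 oD subD])
  have "B \<inter> U \<subseteq> N"
  proof
    fix n assume n: "n \<in> B \<inter> U"
    have "a \<otimes> n \<otimes> b \<in> K \<longleftrightarrow> a \<otimes> b \<in> K" if "a \<in> U" "b \<in> U" for a b
    proof -
      have "((a, b), n) \<in> ?D" using AB n that by blast
      then show ?thesis by auto
    qed
    then show "n \<in> N" using n by (auto simp: N_def)
  qed
  then have "open_subgroup N"
    using open_subgroupI[OF Nsub, of "B \<inter> U"] AB U'(3) Um(3) by (auto simp: openin_Int)
  moreover have "N \<lhd> (G\<lparr>carrier := U\<rparr>)"
    using group.normal_inv_iff[OF subgroup_imp_group[OF U'(1)]] subgroup_incl[OF Nsub U'(1)] conj
    by (auto simp: N_def m_inv_consistent[OF U'(1)])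
  ultimately show thesis using that NK K(4) by blast
qed

lemma open_subgroup_neighbourhood:
  assumes "openin T W" "\<one> \<in> W"
  obtains V where "open_subgroup V" "V \<subseteq> W"
proof -
  obtain U where "compact_open U" using compact_open_exists .
  then show thesis using normal_neighbourhood[OF _ assms] that by blast
qed

text \<open>The cosets of \<open>N\<close> cover \<open>U\<close> by pairwise disjoint open sets, so
  a finite subcover already contains all of them.\<close>

lemma finite_quotient:
  assumes U: "compact_open U" and N: "open_subgroup N" "N \<lhd> (G\<lparr>carrier := U\<rparr>)"
  shows "finite (carrier ((G\<lparr>carrier := U\<rparr>) Mod N))"
proof -
  let ?C = "(\<lambda>u. N #> u) ` U"
  have U': "subgroup U G" "compactin T U" "openin T U" using U by (auto simp: compact_open_subgroup_def)
  have Uc: "U \<subseteq> carrier G" using U' subgroup.subset by blast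
  have "openin T c" if "c \<in> ?C" for c
  proof -
    from that obtain u where "u \<in> U" "c = N #> u" by blast
    moreover have "N #> u = (\<lambda>n. n \<otimes> u) ` N" by (auto simp: r_coset_def)
    ultimately show ?thesis using open_right_translate[of u N] Uc N(1) by (auto simp: open_subgroup_def)
  qed
  moreover have "U \<subseteq> \<Union>?C"
    using rcos_self[OF _ open_subgroup_subgroup[OF N(1)]] Uc by blast
  ultimately obtain F where F: "finite F" "F \<subseteq> ?C" "U \<subseteq> \<Union>F"
    using U'(2) unfolding compactin_def by meson
  have "?C \<subseteq> F"
  proof
    fix c assume "c \<in> ?C"
    then obtain u where u: "u \<in> U" "c = N #> u" by blast
    then obtain d where d: "d \<in> F" "u \<in> d" using F by blast
    then obtain v where "v \<in> U" "d = N #> v" using F by blast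
    then have "c = d" using u d repr_independence[OF _ _ open_subgroup_subgroup[OF N(1)], of u v] Uc by auto
    then show "c \<in> F" using d by simp
  qed
  moreover have "carrier ((G\<lparr>carrier := U\<rparr>) Mod N) = ?C"
    by (simp add: carrier_FactGroup r_coset_def)
  ultimately show ?thesis using F(1) finite_subset by simp
qed

section \<open>Passing from all open subgroups to the limit\<close>

lemma finite_open_subgroup_Inter:
  assumes "finite \<V>" "\<And>V. V \<in> \<V> \<Longrightarrow> open_subgroup V"
  obtains W where "open_subgroup W" "\<And>V. V \<in> \<V> \<Longrightarrow> W \<subseteq> V"
proof -
  have "\<exists>W. open_subgroup W \<and> (\<forall>V\<in>\<V>. W \<subseteq> V)"
    using assms
  proof (induction \<V>)
    case empty
    then show ?case using open_subgroup_carrier by blast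
  next
    case (insert V \<V>)
    then obtain W where "open_subgroup W" "\<forall>V\<in>\<V>. W \<subseteq> V" by auto
    then show ?case using insert.prems open_subgroup_Int[of V W] by (intro exI[of _ "V \<inter> W"]) auto
  qed
  then show thesis using that by blast
qed

text \<open>Finitely many open subgroups contain a common one, so for a family decreasing with
  \<open>V\<close> the finite intersection property only asks that each single \<open>F V\<close>
  meets \<open>K\<close>. This turns solutions modulo every open subgroup into one exact
  solution.\<close>

lemma compact_family_inter:
  assumes K: "compactin T K"
    and cl: "\<And>V. open_subgroup V \<Longrightarrow> closedin T (F V)"
    and ne: "\<And>V. open_subgroup V \<Longrightarrow> K \<inter> F V \<noteq> {}"
    and mono: "\<And>V W. open_subgroup V \<Longrightarrow> open_subgroup W \<Longrightarrow> W \<subseteq> V \<Longrightarrow> F W \<subseteq> F V"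
  obtains x where "x \<in> K" "\<forall>V. open_subgroup V \<longrightarrow> x \<in> F V"
proof -
  have "K \<inter> \<Inter>(F ` Collect open_subgroup) \<noteq> {}"
  proof -
    have "K \<inter> \<Inter>\<F> \<noteq> {}" if \<F>: "finite \<F>" "\<F> \<subseteq> F ` Collect open_subgroup" for \<F>
    proof -
      obtain \<V> where \<V>: "\<V> \<subseteq> Collect open_subgroup" "finite \<V>" "\<F> = F ` \<V>"
        using finite_subset_image[OF \<F>] by blast
      obtain W where W: "open_subgroup W" "\<And>V. V \<in> \<V> \<Longrightarrow> W \<subseteq> V"
        using finite_open_subgroup_Inter[OF \<V>(2)] \<V>(1) by blast
      have "F W \<subseteq> F V" if "V \<in> \<V>" for V
        using mono[of V W] W that \<V>(1) by blast
      then have "F W \<subseteq> \<Inter>\<F>" using \<V>(3) by blast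
      then show ?thesis using ne[OF W(1)] by blast
    qed
    moreover have "\<forall>C\<in>F ` Collect open_subgroup. closedin T C" using cl by auto
    ultimately show ?thesis using K unfolding compactin_fip by blast
  qed
  then show thesis using that by auto
qed

lemma eq_one_if_in_all_open_subgroup:
  assumes x: "x \<in> carrier G" and V: "\<And>V. open_subgroup V \<Longrightarrow> x \<in> V"
  shows "x = \<one>"
proof (rule ccontr)
  assume "x \<noteq> \<one>"
  then obtain A B where AB: "openin T A" "\<one> \<in> A" "x \<in> B" "disjnt A B"
    using Hausdorff x one_closed unfolding Hausdorff_space_def topspace_eq by metis
  obtain W where "open_subgroup W" "W \<subseteq> A" using open_subgroup_neighbourhood[OF AB(1,2)] .
  then show False using V AB by (auto simp: disjnt_def)
qed

section \<open>Closures of cyclic subgroups\<close>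

context
  fixes g assumes g: "g \<in> carrier G"
begin

text \<open>The left cosets of open subgroups form neighbourhood bases, so lying in the closure
  means being a power of \<open>g\<close> modulo every \<open>V\<close>. Many facts on the closure
  are read off from this congruence.\<close>

lemma mono_closure_iff:
  "x \<in> mono_closure G T g \<longleftrightarrow>
    x \<in> carrier G \<and> (\<forall>V. open_subgroup V \<longrightarrow> (\<exists>k::int. inv (g [^] k) \<otimes> x \<in> V))" (is "?L \<longleftrightarrow> ?R")
proof
  assume L: ?L
  then have x: "x \<in> carrier G"
    by (auto simp: mono_closure_def in_closure_of topspace_eq)
  have "\<exists>k::int. inv (g [^] k) \<otimes> x \<in> V" if V: "open_subgroup V" for V
  proof -
    let ?S = "(\<lambda>v. x \<otimes> v) ` V"
    have "openin T ?S" "x \<in> ?S"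
      using open_left_translate[OF x] self_in_left_coset[OF V x] V by (auto simp: open_subgroup_def)
    then obtain y where "y \<in> generate G {g}" "y \<in> ?S"
      using L unfolding mono_closure_def in_closure_of by meson
    then obtain k :: int and v where kv: "x \<otimes> v = g [^] k" "v \<in> V"
      using generate_pow[OF g] by auto
    have vc: "v \<in> carrier G" using kv V subgroup.mem_carrier open_subgroup_subgroup by metis
    have "inv (g [^] k) \<otimes> x = inv v"
      using x vc by (simp add: kv(1)[symmetric] inv_mult_group m_assoc)
    then show ?thesis using kv V by (metis open_subgroup_subgroup subgroup.m_inv_closed)
  qed
  with x show ?R by blast
next
  assume R: ?R
  then have x: "x \<in> carrier G" by blast
  show ?L
    unfolding mono_closure_def in_closure_of
  proof (intro conjI allI impI)
    show "x \<in> topspace T" using x topspace_eq by simp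
    fix S assume S: "x \<in> S \<and> openin T S"
    let ?W = "{w \<in> topspace T. x \<otimes> w \<in> S}"
    have "openin T ?W" using openin_continuous_map_preimage[OF continuous_map_translate(1)[OF x]] S by blast
    moreover have "\<one> \<in> ?W" using S x topspace_eq by simp
    ultimately obtain V where V: "open_subgroup V" "V \<subseteq> ?W" using open_subgroup_neighbourhood by metis
    obtain k :: int where k: "inv (g [^] k) \<otimes> x \<in> V" using R V(1) by blast
    then have "inv (inv (g [^] k) \<otimes> x) \<in> V"
      using subgroup.m_inv_closed[OF open_subgroup_subgroup[OF V(1)]] by blast
    then have "x \<otimes> inv (inv (g [^] k) \<otimes> x) \<in> S" using V(2) by blast
    moreover have "x \<otimes> inv (inv (g [^] k) \<otimes> x) = g [^] k"
      using x g by (simp add: inv_mult_group m_assoc[symmetric])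
    ultimately show "\<exists>y. y \<in> generate G {g} \<and> y \<in> S" using generate_pow[OF g] by auto
  qed
qed

lemma mono_closure_minimal:
  assumes "subgroup H G" "closedin T H" "g \<in> H"
  shows "mono_closure G T g \<subseteq> H"
  unfolding mono_closure_def
  using assms generate_subgroup_incl[of "{g}" H] by (intro closure_of_minimal) auto

lemma mono_closure_subset_open_subgroup: "open_subgroup V \<Longrightarrow> g \<in> V \<Longrightarrow> mono_closure G T g \<subseteq> V"
  using mono_closure_minimal open_subgroup_closed open_subgroup_subgroup by blast

lemma int_pow_in_mono_closure: "g [^] (k::int) \<in> mono_closure G T g"
  unfolding mono_closure_iff using g subgroup.one_closed[OF open_subgroup_subgroup]
  by (auto intro!: exI[of _ k])

lemma self_in_mono_closure: "g \<in> mono_closure G T g"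
  using int_pow_in_mono_closure[of 1] g by simp

lemma mono_closure_closed: "closedin T (mono_closure G T g)"
  by (simp add: mono_closure_def)

lemma mono_closure_carrier: "mono_closure G T g \<subseteq> carrier G"
  using mono_closure_iff by blast

lemma mono_closure_compact: "compactin T (mono_closure G T g)"
proof -
  obtain U where U: "compact_open U" "{g} \<subseteq> U" using compact_open_superset[of "{g}"] g by auto
  then have "mono_closure G T g \<subseteq> U" using mono_closure_subset_open_subgroup compact_open_imp_open_subgroup by blast
  then show ?thesis
    using closed_compactin[of T U] U mono_closure_closed by (auto simp: compact_open_subgroup_def)
qed

text \<open>The centralizer of \<open>y\<close> is the set where left and right translation by
  \<open>y\<close> agree, hence closed in a Hausdorff group. Two applications make the closure of
  the cyclic group abelian.\<close>

lemma mono_closure_commute_gen: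
  assumes y: "y \<in> carrier G" "g \<otimes> y = y \<otimes> g" and x: "x \<in> mono_closure G T g"
  shows "x \<otimes> y = y \<otimes> x"
proof -
  let ?C = "{x \<in> carrier G. x \<otimes> y = y \<otimes> x}"
  have "subgroup ?C G"
    by (rule subgroupI) (use y in \<open>auto intro!: exI[of _ \<one>] commute_inv commute_mult\<close>)
  moreover have "closedin T ?C"
    using closedin_continuous_maps_eq[OF Hausdorff continuous_map_translate(2)[OF y(1)] continuous_map_translate(1)[OF y(1)]]
    by (simp add: topspace_eq)
  ultimately have "mono_closure G T g \<subseteq> ?C"
    by (rule mono_closure_minimal) (use g y in auto)
  then show ?thesis using x by blast
qed

lemma mono_closure_commute:
  assumes "x \<in> mono_closure G T g" "y \<in> mono_closure G T g"
  shows "x \<otimes> y = y \<otimes> x"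
proof (rule mono_closure_commute_gen[OF _ _ assms(1)])
  show "g \<otimes> y = y \<otimes> g" using mono_closure_commute_gen[OF g refl assms(2)] by simp
qed (use assms mono_closure_carrier in auto)

lemma mono_closure_subgroup: "subgroup (mono_closure G T g) G"
proof (rule subgroupI)
  show "mono_closure G T g \<noteq> {}" using self_in_mono_closure by blast
next
  fix x assume x: "x \<in> mono_closure G T g"
  have xc: "x \<in> carrier G" using x mono_closure_carrier by blast
  have "\<exists>k::int. inv (g [^] k) \<otimes> inv x \<in> V" if V: "open_subgroup V" for V
  proof -
    obtain k :: int where k: "inv (g [^] k) \<otimes> x \<in> V" using x V mono_closure_iff by blast
    have "inv (inv (g [^] k) \<otimes> x) \<in> V" using k V by (metis open_subgroup_subgroup subgroup.m_inv_closed)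
    moreover have "inv (inv (g [^] k) \<otimes> x) = inv x \<otimes> g [^] k"
      using xc g by (simp add: inv_mult_group)
    moreover have "\<dots> = g [^] k \<otimes> inv x"
      using commute_inv[OF xc _ mono_closure_commute[OF x int_pow_in_mono_closure]] g by simp
    moreover have "g [^] k = inv (g [^] (- k))" using g by (simp add: int_pow_neg)
    ultimately show ?thesis by metis
  qed
  then show "inv x \<in> mono_closure G T g" using xc mono_closure_iff by simp
next
  fix x y assume x: "x \<in> mono_closure G T g" and y: "y \<in> mono_closure G T g"
  have xc: "x \<in> carrier G" and yc: "y \<in> carrier G" using x y mono_closure_carrier by auto
  have "\<exists>k::int. inv (g [^] k) \<otimes> (x \<otimes> y) \<in> V" if V: "open_subgroup V" for V
  proof -
    obtain k :: int where k: "inv (g [^] k) \<otimes> x \<in> V" using x V mono_closure_iff by blast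
    obtain l :: int where l: "inv (g [^] l) \<otimes> y \<in> V" using y V mono_closure_iff by blast
    have "(inv (g [^] k) \<otimes> x) \<otimes> (inv (g [^] l) \<otimes> y) \<in> V"
      using k l V by (metis open_subgroup_subgroup subgroup.m_closed)
    moreover have "x \<otimes> inv (g [^] l) = inv (g [^] l) \<otimes> x"
      using commute_inv[OF _ xc mono_closure_commute[OF int_pow_in_mono_closure x]] g by simp
    then have "(inv (g [^] k) \<otimes> x) \<otimes> (inv (g [^] l) \<otimes> y) = inv (g [^] k) \<otimes> (inv (g [^] l) \<otimes> x) \<otimes> y"
      using g xc yc by (metis int_pow_closed inv_closed m_assoc m_closed)
    moreover have "\<dots> = inv (g [^] (l + k)) \<otimes> (x \<otimes> y)"
      using g xc yc by (simp add: int_pow_mult inv_mult_group m_assoc)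
    ultimately show ?thesis by metis
  qed
  then show "x \<otimes> y \<in> mono_closure G T g" using xc yc mono_closure_iff by simp
qed (use mono_closure_carrier in auto)

text \<open>In the abelian closure, taking \<open>n\<close>-th powers is multiplicative. Membership
  of the \<open>n\<close>-th power in \<open>V\<close> therefore depends only on the left coset,
  although \<open>V\<close> is not assumed normal.\<close>

lemma mono_closure_pow_coset:
  fixes n :: nat
  assumes x: "x \<in> mono_closure G T g" and y: "y \<in> mono_closure G T g" and V: "subgroup V G"
    and xy: "inv x \<otimes> y \<in> V" and xn: "x [^] n \<in> V"
  shows "y [^] n \<in> V"
proof -
  let ?v = "inv x \<otimes> y"
  have c: "x \<in> carrier G" "y \<in> carrier G" using x y mono_closure_carrier by auto
  have v: "?v \<in> mono_closure G T g"
    using x y mono_closure_subgroup by (simp add: subgroup.m_closed subgroup.m_inv_closed)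
  have "y = x \<otimes> ?v" using c by (simp add: m_assoc[symmetric])
  then have "y [^] n = x [^] n \<otimes> ?v [^] n"
    using pow_mult_distrib[OF mono_closure_commute[OF x v], of n] c by simp
  then show ?thesis
    using xn subgroup_nat_pow_closed[OF V xy, of n] V by (simp add: subgroup.m_closed)
qed

lemma mono_closure_pow_in:
  fixes n :: nat
  assumes x: "x \<in> mono_closure G T g" and V: "open_subgroup V" and n: "g [^] n \<in> V"
  shows "x [^] n \<in> V"
proof -
  obtain k :: int where k: "inv (g [^] k) \<otimes> x \<in> V" using x V mono_closure_iff by blast
  have "(g [^] k) [^] n = (g [^] n) [^] k"
    using g by (metis int_pow_int int_pow_pow mult.commute)
  then have "(g [^] k) [^] n \<in> V" using subgroup_int_pow_closed[OF open_subgroup_subgroup[OF V] n] by simp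
  then show ?thesis
    using mono_closure_pow_coset[OF int_pow_in_mono_closure x open_subgroup_subgroup[OF V] k] by blast
qed

end


subsection \<open>\<open>\<sigma>\<close>-elements\<close>

text \<open>Asking for some \<sigma>-number as exponent amounts to asking that the order modulo
  \<open>V\<close> be a \<sigma>-number, since this order divides every exponent. The condition
  passes directly to finite quotients, and \<open>sigma_element_iff_pi_element\<close> identifies it
  with \<open>sigma_element\<close>.\<close>

definition pi_element :: "nat set \<Rightarrow> 'a \<Rightarrow> bool" where
  "pi_element \<sigma> g \<longleftrightarrow> g \<in> carrier G \<and> (\<forall>V. open_subgroup V \<longrightarrow> (\<exists>n. pi_number \<sigma> n \<and> g [^] n \<in> V))"

lemma pi_element_carrier: "pi_element \<sigma> g \<Longrightarrow> g \<in> carrier G"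
  by (simp add: pi_element_def)

lemma pi_element_pow: "pi_element \<sigma> g \<Longrightarrow> open_subgroup V \<Longrightarrow> \<exists>n. pi_number \<sigma> n \<and> g [^] n \<in> V"
  by (simp add: pi_element_def)

lemma pi_element_mono: "pi_element \<sigma> g \<Longrightarrow> \<sigma> \<subseteq> \<tau> \<Longrightarrow> pi_element \<tau> g"
  unfolding pi_element_def using pi_number_mono by blast

lemma pi_element_one: "pi_element \<sigma> \<one>"
  unfolding pi_element_def using subgroup.one_closed[OF open_subgroup_subgroup] pi_number_1 by fastforce

lemma pi_element_disjoint:
  assumes "pi_element \<sigma> g" "pi_element (- \<sigma>) g" shows "g = \<one>"
proof (rule eq_one_if_in_all_open_subgroup)
  show gc: "g \<in> carrier G" using assms by (simp add: pi_element_def)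
  fix V assume V: "open_subgroup V"
  obtain m n where mn: "pi_number \<sigma> m" "g [^] m \<in> V" "pi_number (- \<sigma>) n" "g [^] n \<in> V"
    using pi_element_pow[OF assms(1) V] pi_element_pow[OF assms(2) V] by blast
  show "g \<in> V"
    by (rule coprime_pow_in_subgroup[OF open_subgroup_subgroup[OF V] gc pi_number_coprime[OF mn(1,3)] mn(2,4)])
qed

lemma pi_element_inv: assumes "pi_element \<sigma> g" shows "pi_element \<sigma> (inv g)"
  unfolding pi_element_def
proof (intro conjI allI impI)
  show "inv g \<in> carrier G" using assms by (simp add: pi_element_def)
  fix V assume V: "open_subgroup V"
  obtain n where n: "pi_number \<sigma> n" "g [^] n \<in> V" using pi_element_pow[OF assms V] by blast
  then have "inv g [^] n \<in> V"
    using assms V by (simp add: nat_pow_inv pi_element_def subgroup.m_inv_closed[OF open_subgroup_subgroup])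
  with n show "\<exists>n. pi_number \<sigma> n \<and> inv g [^] n \<in> V" by blast
qed

lemma pi_element_mono_closure:
  assumes "pi_element \<sigma> g" "x \<in> mono_closure G T g" shows "pi_element \<sigma> x"
proof -
  have g: "g \<in> carrier G" using assms by (simp add: pi_element_def)
  have "x \<in> carrier G" using mono_closure_carrier[OF g] assms by blast
  moreover have "\<exists>n. pi_number \<sigma> n \<and> x [^] n \<in> V" if V: "open_subgroup V" for V
    using pi_element_pow[OF assms(1) V] mono_closure_pow_in[OF g assms(2) V] by blast
  ultimately show ?thesis by (simp add: pi_element_def)
qed

lemma conj_nat_pow:
  assumes "h \<in> carrier G" "x \<in> carrier G"
  shows "(h \<otimes> x \<otimes> inv h) [^] (n::nat) = h \<otimes> x [^] n \<otimes> inv h"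
proof (induction n)
  case (Suc n)
  have "(h \<otimes> x [^] n \<otimes> inv h) \<otimes> (h \<otimes> x \<otimes> inv h) = h \<otimes> x [^] n \<otimes> (inv h \<otimes> h) \<otimes> x \<otimes> inv h"
    using assms by (simp only: m_assoc m_closed inv_closed nat_pow_closed)
  also have "\<dots> = h \<otimes> (x [^] n \<otimes> x) \<otimes> inv h"
    using assms by (simp add: m_assoc)
  finally show ?case using Suc by simp
qed (use assms in simp)

text \<open>Conjugation by \<open>h\<close> is continuous, so the elements that it sends into
  \<open>V\<close> form an open subgroup; an exponent of \<open>x\<close> modulo that subgroup
  serves for the conjugate.\<close>

lemma pi_element_conj: assumes x: "pi_element \<sigma> x" and h: "h \<in> carrier G" shows "pi_element \<sigma> (h \<otimes> x \<otimes> inv h)"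
  unfolding pi_element_def
proof (intro conjI allI impI)
  have xc: "x \<in> carrier G" using x by (simp add: pi_element_def)
  then show "h \<otimes> x \<otimes> inv h \<in> carrier G" using h by simp
  fix V assume V: "open_subgroup V"
  let ?V = "{y \<in> topspace T. h \<otimes> y \<otimes> inv h \<in> V}"
  have sV: "subgroup V G" and oV: "openin T V" using V by (auto simp: open_subgroup_def)
  have "continuous_map T T (\<lambda>y. h \<otimes> y \<otimes> inv h)"
    using continuous_map_compose[OF continuous_map_translate(1)[OF h] continuous_map_translate(2)[of "inv h"]] h
    by (simp add: o_def)
  then have "openin T ?V" using openin_continuous_map_preimage oV by blast
  moreover have "subgroup ?V G"
  proof (rule subgroupI)
    show "?V \<subseteq> carrier G" by (auto simp: topspace_eq)
    have "\<one> \<in> ?V" using h subgroup.one_closed[OF sV] by (simp add: topspace_eq)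
    then show "?V \<noteq> {}" by blast
    show "inv a \<in> ?V" if "a \<in> ?V" for a
    proof -
      have "inv (h \<otimes> a \<otimes> inv h) \<in> V" using that subgroup.m_inv_closed[OF sV] by blast
      then show ?thesis using that h by (simp add: topspace_eq inv_mult_group m_assoc)
    qed
    show "a \<otimes> b \<in> ?V" if "a \<in> ?V" "b \<in> ?V" for a b
    proof -
      have c: "a \<in> carrier G" "b \<in> carrier G" using that by (auto simp: topspace_eq)
      have "(h \<otimes> a \<otimes> inv h) \<otimes> (h \<otimes> b \<otimes> inv h) \<in> V" using that subgroup.m_closed[OF sV] by blast
      moreover have "(h \<otimes> a \<otimes> inv h) \<otimes> (h \<otimes> b \<otimes> inv h) = h \<otimes> a \<otimes> (inv h \<otimes> h) \<otimes> b \<otimes> inv h"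
        using c h by (simp only: m_assoc m_closed inv_closed)
      ultimately show ?thesis using c h by (simp add: topspace_eq m_assoc)
    qed
  qed
  ultimately have "open_subgroup ?V" by (simp add: open_subgroup_def)
  then obtain n where "pi_number \<sigma> n" "x [^] n \<in> ?V" using pi_element_pow[OF x] by blast
  then show "\<exists>n. pi_number \<sigma> n \<and> (h \<otimes> x \<otimes> inv h) [^] n \<in> V"
    using conj_nat_pow[OF h xc] by auto
qed

section \<open>The finite quotients of a compact open subgroup\<close>

context
  fixes U N assumes U: "compact_open U" and N: "open_subgroup N" "N \<lhd> (G\<lparr>carrier := U\<rparr>)"
begin

abbreviation "quot \<equiv> (G\<lparr>carrier := U\<rparr>) Mod N"

lemma quotient_group: "group quot"
  using normal.factorgroup_is_group[OF N(2)] .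

lemma quotient_hom: "(\<lambda>u. N #> u) \<in> hom (G\<lparr>carrier := U\<rparr>) quot"
  using normal.r_coset_hom_Mod[OF N(2)] by (simp add: r_coset_def)

lemma quotient_carrier: "carrier quot = (\<lambda>u. N #> u) ` U"
  by (simp add: carrier_FactGroup r_coset_def)

lemma quotient_mult: "u \<in> U \<Longrightarrow> v \<in> U \<Longrightarrow> N #> (u \<otimes> v) = (N #> u) \<otimes>\<^bsub>quot\<^esub> (N #> v)"
  using hom_mult[OF quotient_hom, of u v] by simp

lemma quotient_pow: "u \<in> U \<Longrightarrow> N #> (u [^] (n::nat)) = (N #> u) [^]\<^bsub>quot\<^esub> n"
  using hom_nat_pow[OF quotient_hom, of u n] quotient_group subgroup_imp_group U
  by (simp add: compact_open_subgroup_def nat_pow_consistent[symmetric])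

lemma quotient_one: "u \<in> U \<Longrightarrow> N #> u = \<one>\<^bsub>quot\<^esub> \<longleftrightarrow> u \<in> N"
  using coset_join1[OF _ _ open_subgroup_subgroup[OF N(1)], of u] coset_join2[OF _ open_subgroup_subgroup[OF N(1)], of u] compact_open_imp_open_subgroup[OF U]
    subgroup.mem_carrier[OF open_subgroup_subgroup, of U u] subgroup.subset[OF open_subgroup_subgroup[OF N(1)]] by auto

lemma quotient_exponent: obtains n :: nat where "n > 0" "\<forall>u\<in>U. u [^] n \<in> N"
proof
  show "order quot > 0"
    using finite_quotient[OF U N] group.is_monoid[OF quotient_group] monoid.one_closed
    by (fastforce simp: order_def card_gt_0_iff)
  show "\<forall>u\<in>U. u [^] order quot \<in> N"
  proof
    fix u assume u: "u \<in> U"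
    then have "(N #> u) [^]\<^bsub>quot\<^esub> order quot = \<one>\<^bsub>quot\<^esub>"
      using group.pow_order_eq_1[OF quotient_group] quotient_carrier by blast
    then show "u [^] order quot \<in> N"
      using quotient_one[of "u [^] order quot"] quotient_pow[OF u]
        subgroup_nat_pow_closed[OF open_subgroup_subgroup[OF compact_open_imp_open_subgroup[OF U]] u] by metis
  qed
qed

text \<open>In contrast to \<open>mono_closure_pow_coset\<close>, the two elements need not commute;
  normality of \<open>N\<close> in \<open>U\<close> makes the powers depend on the coset
  alone.\<close>

lemma quotient_pow_coset:
  fixes n :: nat
  assumes u: "u \<in> U" "v \<in> U" and uv: "inv u \<otimes> v \<in> N" and un: "u [^] n \<in> N"
  shows "v [^] n \<in> N" and "N #> v = N #> u"
proof -
  have sU: "subgroup U G" using U by (simp add: compact_open_subgroup_def)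
  have c: "u \<in> carrier G" "v \<in> carrier G" using u subgroup.mem_carrier[OF sU] by auto
  have w: "inv u \<otimes> v \<in> U" using u sU by (simp add: subgroup.m_closed subgroup.m_inv_closed)
  have "v = u \<otimes> (inv u \<otimes> v)" using c by (simp add: m_assoc[symmetric])
  then have "N #> v = (N #> u) \<otimes>\<^bsub>quot\<^esub> (N #> (inv u \<otimes> v))"
    using quotient_mult[OF u(1) w] by simp
  also have "N #> (inv u \<otimes> v) = \<one>\<^bsub>quot\<^esub>" using quotient_one[OF w] uv by blast
  also have "(N #> u) \<otimes>\<^bsub>quot\<^esub> \<one>\<^bsub>quot\<^esub> = N #> u"
    by (rule monoid.r_one[OF group.is_monoid[OF quotient_group]]) (use quotient_carrier u(1) in blast)
  finally show eq: "N #> v = N #> u" .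
  show "v [^] n \<in> N"
    using eq quotient_pow[OF u(1), of n] quotient_pow[OF u(2), of n] un
      quotient_one[OF subgroup_nat_pow_closed[OF sU u(1)], of n]
      quotient_one[OF subgroup_nat_pow_closed[OF sU u(2)], of n] by simp
qed

end

text \<open>The exponent comes from a finite group: \<open>g\<close> lies in a compact open
  \<open>U\<close>, and \<open>V\<close> contains an open normal subgroup of \<open>U\<close>, whose
  index in \<open>U\<close> is finite.\<close>

lemma open_subgroup_pow_exists:
  assumes "g \<in> carrier G" "open_subgroup V"
  obtains n :: nat where "n > 0" "g [^] n \<in> V"
proof -
  obtain U where U: "compact_open U" "{g} \<subseteq> U" using compact_open_superset[of "{g}"] assms by auto
  have "openin T V" "\<one> \<in> V" using assms(2) subgroup.one_closed by (auto simp: open_subgroup_def)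
  from normal_neighbourhood[OF U(1) this] obtain N where N: "open_subgroup N" "N \<subseteq> V" "N \<lhd> (G\<lparr>carrier := U\<rparr>)" .
  obtain n :: nat where "n > 0" "\<forall>u\<in>U. u [^] n \<in> N" using quotient_exponent[OF U(1) N(1,3)] .
  then show thesis using that[of n] U(2) N(2) by auto
qed

lemma order_modulo_open_subgroup:
  assumes "g \<in> carrier G" "open_subgroup V"
  obtains d :: nat where "d > 0" "\<forall>m::nat. g [^] m \<in> V \<longleftrightarrow> d dvd m"
proof -
  obtain n :: nat where "n > 0" "g [^] n \<in> V" using open_subgroup_pow_exists[OF assms] .
  then show thesis
    using order_modulo_subgroup[OF open_subgroup_subgroup[OF assms(2)] assms(1)] that by blast
qed

section \<open>Splitting an element into its \<sigma>-part and its complementary part\<close>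

text \<open>Stands for the primary decomposition of the compact group topologically generated by
  \<open>g\<close>. \<open>F V\<close> is the set of candidates for the \<sigma>-part that are
  correct modulo \<open>V\<close>; these sets are closed, nonempty and decreasing, so compactness
  yields a candidate correct for all \<open>V\<close>.\<close>

lemma pi_element_decomposition:
  assumes g: "g \<in> carrier G"
  obtains a b where "a \<in> mono_closure G T g" "b \<in> mono_closure G T g" "g = a \<otimes> b"
    "pi_element \<sigma> a" "pi_element (- \<sigma>) b"
proof -
  let ?A = "mono_closure G T g"
  define F where "F V = {a \<in> ?A. (\<exists>n. pi_number \<sigma> n \<and> a [^] n \<in> V) \<and>
    (\<exists>m. pi_number (- \<sigma>) m \<and> (inv a \<otimes> g) [^] m \<in> V)}" for V
  note Asub = mono_closure_subgroup[OF g] and Ac = mono_closure_carrier[OF g]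
  have gA: "g \<in> ?A" using self_in_mono_closure[OF g] .
  have Am: "inv a \<otimes> b \<in> ?A" if "a \<in> ?A" "b \<in> ?A" for a b
    using that Asub by (simp add: subgroup.m_closed subgroup.m_inv_closed)
  \<comment> \<open>Around a rejected candidate \<open>a\<close> the whole coset of \<open>V\<close>
    avoids \<open>F V\<close>; this is what makes \<open>F V\<close> closed.\<close>
  have coset: "a \<in> F V" if V: "open_subgroup V" and a: "a \<in> ?A" and v: "v \<in> V" and av: "a \<otimes> v \<in> F V" for a v V
  proof -
    let ?b = "a \<otimes> v"
    have sV: "subgroup V G" using V open_subgroup_subgroup by blast
    have b: "?b \<in> ?A" using av by (simp add: F_def)
    have c: "a \<in> carrier G" "v \<in> carrier G" "?b \<in> carrier G" using a v sV Ac b subgroup.mem_carrier by auto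
    obtain n m where nm: "pi_number \<sigma> n" "?b [^] n \<in> V" "pi_number (- \<sigma>) m" "(inv ?b \<otimes> g) [^] m \<in> V"
      using av by (auto simp: F_def)
    have "v = inv a \<otimes> ?b" using c by (simp add: m_assoc[symmetric])
    then have vA: "v \<in> ?A" using Am[OF a b] by simp
    have "inv ?b \<otimes> a = inv v" using c by (simp add: inv_mult_group m_assoc)
    then have "a [^] n \<in> V"
      using mono_closure_pow_coset[OF g b a sV _ nm(2)] v sV by (simp add: subgroup.m_inv_closed)
    moreover have "inv (inv ?b \<otimes> g) \<otimes> (inv a \<otimes> g) = v"
    proof -
      have ab: "a \<otimes> v = v \<otimes> a" using mono_closure_commute[OF g a vA] .
      have gv: "g \<otimes> v = v \<otimes> g" using mono_closure_commute[OF g gA vA] .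
      have "inv (inv ?b \<otimes> g) \<otimes> (inv a \<otimes> g) = inv g \<otimes> (v \<otimes> a) \<otimes> (inv a \<otimes> g)"
        using c g ab by (simp add: inv_mult_group)
      also have "\<dots> = inv g \<otimes> (v \<otimes> (a \<otimes> inv a) \<otimes> g)"
        using c g by (simp only: m_assoc m_closed inv_closed)
      also have "\<dots> = inv g \<otimes> (g \<otimes> v)" using c g gv by simp
      also have "\<dots> = v" using c g by (simp add: m_assoc[symmetric])
      finally show ?thesis .
    qed
    then have "(inv a \<otimes> g) [^] m \<in> V"
      using mono_closure_pow_coset[OF g Am[OF b gA] Am[OF a gA] sV _ nm(4)] v by simp
    ultimately show ?thesis using a nm by (auto simp: F_def)
  qed
  have cl: "closedin T (F V)" if V: "open_subgroup V" for V
  proof -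
    let ?O = "\<Union>a\<in>?A - F V. (\<lambda>v. a \<otimes> v) ` V"
    have "openin T ?O"
      using open_left_translate V Ac by (intro openin_Union) (auto simp: open_subgroup_def)
    then have "closedin T (?A - ?O)" by (rule closedin_diff[OF mono_closure_closed[OF g]])
    moreover have "?A - ?O = F V"
    proof
      show "F V \<subseteq> ?A - ?O"
      proof
        fix x assume x: "x \<in> F V"
        have "x \<notin> ?O" using coset[OF V] x by blast
        with x show "x \<in> ?A - ?O" by (simp add: F_def)
      qed
      show "?A - ?O \<subseteq> F V" using self_in_left_coset[OF V] Ac by blast
    qed
    ultimately show ?thesis by (simp only:)
  qed
  have ne: "?A \<inter> F V \<noteq> {}" if V: "open_subgroup V" for V
  proof -
    have sV: "subgroup V G" using V open_subgroup_subgroup by blast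
    obtain d :: nat where d: "d > 0" "g [^] d \<in> V" using open_subgroup_pow_exists[OF g V] .
    obtain s t where st: "d = s * t" "pi_number \<sigma> s" "pi_number (- \<sigma>) t" using pi_number_split[OF d(1)] .
    obtain u v where uv: "u * int s + v * int t = 1"
      using bezout_int[of "int s" "int t"] pi_number_coprime[OF st(2,3)]
      by (metis coprime_imp_gcd_eq_1 coprime_int_iff)
    \<comment> \<open>The relation \<open>u * int s + v * int t = 1\<close> splits \<open>g\<close>
      into its powers with exponents \<open>v * int t\<close> and \<open>u * int s\<close>. Since
      \<open>g [^] (s * t)\<close> lies in \<open>V\<close>, the former has exponent
      \<open>s\<close> and the latter exponent \<open>t\<close> modulo \<open>V\<close>.\<close>
    define a where "a = g [^] (v * int t)"
    have aA: "a \<in> ?A" unfolding a_def by (rule int_pow_in_mono_closure[OF g])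
    have "a [^] s = (g [^] d) [^] v"
      unfolding a_def st(1) using g by (simp add: int_pow_int[symmetric] int_pow_pow ac_simps)
    then have 1: "a [^] s \<in> V" using subgroup_int_pow_closed[OF sV d(2)] by simp
    have "inv a \<otimes> g = g [^] (- (v * int t) + 1)"
      using g by (simp only: a_def int_pow_mult int_pow_neg int_pow_1)
    also have "- (v * int t) + 1 = u * int s" using uv by simp
    finally have "(inv a \<otimes> g) [^] t = (g [^] d) [^] u"
      unfolding st(1) using g by (simp add: int_pow_int[symmetric] int_pow_pow ac_simps)
    then have 2: "(inv a \<otimes> g) [^] t \<in> V" using subgroup_int_pow_closed[OF sV d(2)] by simp
    show ?thesis using aA 1 2 st by (auto simp: F_def)
  qed
  have mono: "F W \<subseteq> F V" if "W \<subseteq> V" for V W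
    using that unfolding F_def by blast
  obtain a where a: "a \<in> ?A" "\<forall>V. open_subgroup V \<longrightarrow> a \<in> F V"
    by (rule compact_family_inter[OF mono_closure_compact[OF g] cl ne mono])
  let ?b = "inv a \<otimes> g"
  have ac: "a \<in> carrier G" using a Ac by blast
  have "pi_element \<sigma> a" "pi_element (- \<sigma>) ?b" using a(2) ac g by (auto simp: F_def pi_element_def)
  moreover have "g = a \<otimes> ?b" using ac g by (simp add: m_assoc[symmetric])
  ultimately show thesis using that a(1) Am[OF a(1) gA] by blast
qed

text \<open>If the order of \<open>g\<close> modulo some \<open>V\<close> had a prime factor
  \<open>q\<close> outside \<open>\<sigma>\<close>, the \<open>q\<close>-part of \<open>g\<close>
  would lie in \<open>primary_comp\<close>, hence be trivial, and \<open>g\<close> would have an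
  exponent prime to \<open>q\<close> modulo \<open>V\<close>. Conversely, an element of
  \<open>primary_comp\<close> at such a \<open>q\<close> has powers of \<open>q\<close> as exponents
  by convergence, and it is a \<sigma>-element as a member of the closure.\<close>

lemma sigma_element_iff_pi_element: "sigma_element G T \<sigma> g \<longleftrightarrow> pi_element \<sigma> g"
proof
  assume L: "sigma_element G T \<sigma> g"
  then have g: "g \<in> carrier G" by (simp add: sigma_element_def)
  have "\<exists>n. pi_number \<sigma> n \<and> g [^] n \<in> V" if V: "open_subgroup V" for V
  proof (rule ccontr)
    assume no: "\<not> ?thesis"
    obtain d :: nat where d: "d > 0" "\<forall>m::nat. g [^] m \<in> V \<longleftrightarrow> d dvd m"
      using order_modulo_open_subgroup[OF g V] .
    then have "\<not> pi_number \<sigma> d" using no by (metis dvd_refl)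
    then obtain q where q: "Factorial_Ring.prime q" "q dvd d" "q \<notin> \<sigma>" using d(1) by (auto simp: pi_number_def)
    obtain a b where ab: "a \<in> mono_closure G T g" "g = a \<otimes> b" "pi_element {q} a" "pi_element (- {q}) b"
      using pi_element_decomposition[OF g, of "{q}"] by metis
    have "limitin T (\<lambda>n. a [^] (q ^ n)) \<one> sequentially"
      unfolding limitin_def
    proof (intro conjI allI impI)
      show "\<one> \<in> topspace T" by (simp add: topspace_eq)
      fix S assume "openin T S \<and> \<one> \<in> S"
      then obtain W where W: "open_subgroup W" "W \<subseteq> S" using open_subgroup_neighbourhood by blast
      obtain n where n: "pi_number {q} n" "a [^] n \<in> W" using pi_element_pow[OF ab(3) W(1)] by blast
      obtain k where k: "n = q ^ k" using pi_number_singleton[OF q(1) n(1)] .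
      have "a [^] (q ^ j) \<in> S" if "j \<ge> k" for j
      proof -
        have "a [^] (q ^ j) = (a [^] n) [^] (q ^ (j - k))"
          using that ab(3) by (simp add: k nat_pow_pow power_add[symmetric] pi_element_def)
        then show ?thesis using subgroup_nat_pow_closed[OF open_subgroup_subgroup[OF W(1)] n(2)] W(2) by auto
      qed
      then show "\<forall>\<^sub>F j in sequentially. a [^] (q ^ j) \<in> S" using eventually_sequentially by blast
    qed
    then have "a \<in> primary_comp G T g q" using ab(1) by (simp add: primary_comp_def)
    then have "a = \<one>" using L q by (auto simp: sigma_element_def)
    then have "pi_element (- {q}) g" using ab pi_element_carrier by auto
    then obtain n where n: "pi_number (- {q}) n" "g [^] n \<in> V" using pi_element_pow V by blast
    then have "q dvd n" using d(2) q(2) dvd_trans by blast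
    with n(1) q(1) show False by (auto simp: pi_number_def)
  qed
  with g show "pi_element \<sigma> g" by (simp add: pi_element_def)
next
  assume R: "pi_element \<sigma> g"
  then have g: "g \<in> carrier G" by (simp add: pi_element_def)
  have "primary_comp G T g q = {\<one>}" if q: "Factorial_Ring.prime q" "q \<notin> \<sigma>" for q
  proof
    have "\<one> \<in> mono_closure G T g" using subgroup.one_closed[OF mono_closure_subgroup[OF g]] .
    then show "{\<one>} \<subseteq> primary_comp G T g q" by (auto simp: primary_comp_def limitin_def topspace_eq)
    show "primary_comp G T g q \<subseteq> {\<one>}"
    proof
      fix x assume "x \<in> primary_comp G T g q"
      then have x: "x \<in> mono_closure G T g" and lim: "limitin T (\<lambda>n. x [^] (q ^ n)) \<one> sequentially"
        by (auto simp: primary_comp_def)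
      have xc: "x \<in> carrier G" using x mono_closure_carrier[OF g] by blast
      have "\<exists>n. pi_number (- \<sigma>) n \<and> x [^] n \<in> V" if V: "open_subgroup V" for V
      proof -
        have "openin T V" "\<one> \<in> V" using V subgroup.one_closed by (auto simp: open_subgroup_def)
        then have "\<forall>\<^sub>F n in sequentially. x [^] (q ^ n) \<in> V" using lim by (auto simp: limitin_def)
        then obtain k where "x [^] (q ^ k) \<in> V" using eventually_sequentially by auto
        then show ?thesis using pi_number_prime_power[of q "- \<sigma>" k] q by blast
      qed
      then have "pi_element (- \<sigma>) x" using xc by (simp add: pi_element_def)
      then show "x \<in> {\<one>}" using pi_element_disjoint[OF pi_element_mono_closure[OF R x]] by simp
    qed
  qed
  with g show "sigma_element G T \<sigma> g" by (simp add: sigma_element_def)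
qed

text \<open>Decompose \<open>h\<close> itself: its part \<open>b\<close> prime to \<sigma> has two
  coprime exponents modulo \<open>N\<close>, so it lies in \<open>N\<close>, and the \<sigma>-part
  \<open>a\<close> represents the same coset. Torsion in a finite quotient thus comes from genuine
  \<sigma>-elements.\<close>

lemma pi_element_lift:
  fixes n :: nat
  assumes U: "compact_open U" and N: "open_subgroup N" "N \<lhd> (G\<lparr>carrier := U\<rparr>)"
    and h: "h \<in> U" and n: "pi_number \<sigma> n" "h [^] n \<in> N"
  obtains a where "a \<in> mono_closure G T h" "a \<in> U" "pi_element \<sigma> a" "inv a \<otimes> h \<in> N" "N #> h = N #> a"
proof -
  have sU: "subgroup U G" using U by (simp add: compact_open_subgroup_def)
  have hc: "h \<in> carrier G" using h sU subgroup.mem_carrier by fast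
  obtain a b where ab: "a \<in> mono_closure G T h" "b \<in> mono_closure G T h" "h = a \<otimes> b" "pi_element \<sigma> a" "pi_element (- \<sigma>) b"
    using pi_element_decomposition[OF hc] .
  have aU: "a \<in> U" using ab(1) mono_closure_subset_open_subgroup[OF hc compact_open_imp_open_subgroup[OF U] h] by blast
  obtain m where m: "pi_number (- \<sigma>) m" "b [^] m \<in> N" using pi_element_pow[OF ab(5) N(1)] by blast
  have bc: "b \<in> carrier G" and ac: "a \<in> carrier G" using ab pi_element_carrier by auto
  have "b [^] n \<in> N" using mono_closure_pow_in[OF hc ab(2) N(1) n(2)] .
  then have "b \<in> N"
    using coprime_pow_in_subgroup[OF open_subgroup_subgroup[OF N(1)] bc pi_number_coprime[OF n(1) m(1)] _ m(2)] by blast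
  moreover have "inv a \<otimes> h = b" using ab(3) ac bc by (simp add: m_assoc[symmetric])
  ultimately have "inv a \<otimes> h \<in> N" by simp
  moreover from this have "N #> h = N #> a"
    \<comment> \<open>Exponent 0 reduces the assumption on powers to
      \<open>\<one> \<in> N\<close>.\<close>
    using quotient_pow_coset(2)[OF U N aU h, of 0] subgroup.one_closed[OF open_subgroup_subgroup[OF N(1)]] by simp
  ultimately show thesis using that ab(1,4) aU by blast
qed

text \<open>If no \<sigma>-number is an exponent of \<open>g\<close> modulo \<open>V\<close>, none
  is one modulo a smaller \<open>N\<close> normal in a compact open subgroup containing
  \<open>g\<close>. Powers modulo \<open>N\<close> depend only on the coset, so the whole open coset
  of \<open>g\<close> fails.\<close>

lemma pi_element_closed: "closedin T {g. pi_element \<sigma> g}"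
proof -
  have "openin T (carrier G - {g. pi_element \<sigma> g})"
  proof (subst openin_subopen, intro ballI)
    fix g assume "g \<in> carrier G - {g. pi_element \<sigma> g}"
    then have g: "g \<in> carrier G" "\<not> pi_element \<sigma> g" by auto
    then obtain V where V: "open_subgroup V" "\<And>n. pi_number \<sigma> n \<Longrightarrow> g [^] n \<notin> V" unfolding pi_element_def by blast
    obtain U where U: "compact_open U" "{g} \<subseteq> U" using compact_open_superset[of "{g}"] g by auto
    have sU: "subgroup U G" using U by (simp add: compact_open_subgroup_def)
    have "openin T V" "\<one> \<in> V" using V subgroup.one_closed by (auto simp: open_subgroup_def)
    from normal_neighbourhood[OF U(1) this] obtain N where N: "open_subgroup N" "N \<subseteq> V" "N \<lhd> (G\<lparr>carrier := U\<rparr>)" .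
    have NU: "N \<subseteq> U" using normal_imp_subgroup[OF N(3)] subgroup.subset by fastforce
    let ?S = "(\<lambda>v. g \<otimes> v) ` N"
    have "\<not> pi_element \<sigma> (g \<otimes> v)" if v: "v \<in> N" for v
    proof
      assume "pi_element \<sigma> (g \<otimes> v)"
      then obtain n where n: "pi_number \<sigma> n" "(g \<otimes> v) [^] n \<in> N" using pi_element_pow N(1) by blast
      have vc: "v \<in> carrier G" using v N(1) open_subgroup_subgroup subgroup.mem_carrier by fast
      have "inv (g \<otimes> v) \<otimes> g = inv v" using g vc by (simp add: inv_mult_group m_assoc)
      then have "inv (g \<otimes> v) \<otimes> g \<in> N" using v N(1) open_subgroup_subgroup subgroup.m_inv_closed by metis
      then have "g [^] n \<in> N"
        using quotient_pow_coset(1)[OF U(1) N(1,3), of "g \<otimes> v" g n] U(2) n(2) v NU sU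
        by (simp add: subgroup.m_closed subset_iff)
      then show False using V(2)[OF n(1)] N(2) by blast
    qed
    moreover have "openin T ?S" using open_left_translate g N(1) by (auto simp: open_subgroup_def)
    moreover have "g \<in> ?S" using self_in_left_coset N(1) g by blast
    ultimately show "\<exists>S. openin T S \<and> g \<in> S \<and> S \<subseteq> carrier G - {g. pi_element \<sigma> g}"
      using open_subset_carrier[of ?S] by (intro exI[of _ ?S]) auto
  qed
  then show ?thesis by (auto simp: closedin_def topspace_eq pi_element_def)
qed

section \<open>Sets of primes whose elements commute with the complementary ones\<close>

text \<open>The commutator condition of \<open>nu\<close>, elementwise and for arbitrary sets: it is
  needed for single primes, for \<open>nu\<close> as a whole, and for the complement of
  \<open>nu\<close>.\<close>

definition pi_split :: "nat set \<Rightarrow> bool" where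
  "pi_split \<sigma> \<longleftrightarrow> (\<forall>x y. pi_element \<sigma> x \<longrightarrow> pi_element (- \<sigma>) y \<longrightarrow> x \<otimes> y = y \<otimes> x)"

lemma pi_split_Compl: "pi_split \<sigma> \<Longrightarrow> pi_split (- \<sigma>)"
  unfolding pi_split_def by (metis double_compl)

text \<open>The hypotheses of \<open>pi_torsion_mult_closed\<close> hold in a finite quotient of a
  compact open subgroup containing \<open>x\<close> and \<open>y\<close>, because torsion lifts to
  genuine elements of the same type, which commute by \<open>pi_split\<close>. The exponent found
  modulo \<open>N\<close> then serves modulo \<open>V\<close>.\<close>

lemma pi_element_mult:
  assumes sp: "pi_split \<sigma>" and x: "pi_element \<sigma> x" and y: "pi_element \<sigma> y"
  shows "pi_element \<sigma> (x \<otimes> y)"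
  unfolding pi_element_def
proof (intro conjI allI impI)
  have c: "x \<in> carrier G" "y \<in> carrier G" using x y pi_element_carrier by auto
  then show "x \<otimes> y \<in> carrier G" by simp
  fix V assume V: "open_subgroup V"
  obtain U where U: "compact_open U" "{x, y} \<subseteq> U" using compact_open_superset[of "{x, y}"] c by auto
  have sU: "subgroup U G" using U by (simp add: compact_open_subgroup_def)
  have "openin T V" "\<one> \<in> V" using V subgroup.one_closed by (auto simp: open_subgroup_def)
  from normal_neighbourhood[OF U(1) this] obtain N where N: "open_subgroup N" "N \<subseteq> V" "N \<lhd> (G\<lparr>carrier := U\<rparr>)" .
  let ?Q = "(G\<lparr>carrier := U\<rparr>) Mod N"
  interpret Q: group ?Q by (rule quotient_group[OF U(1) N(1,3)])
  have lift: "\<exists>a. a \<in> U \<and> pi_element \<tau> a \<and> c = N #> a" if cQ: "c \<in> Q.pi_torsion \<tau>" for c \<tau>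
  proof -
    obtain n where n: "pi_number \<tau> n" "c [^]\<^bsub>?Q\<^esub> n = \<one>\<^bsub>?Q\<^esub>" and "c \<in> carrier ?Q"
      using cQ unfolding Q.pi_torsion_def by blast
    then obtain h where h: "h \<in> U" "c = N #> h" using quotient_carrier[OF U(1) N(1,3)] by blast
    have "h [^] n \<in> N"
      using n(2) h quotient_pow[OF U(1) N(1,3) h(1), of n] quotient_one[OF U(1) N(1,3), of "h [^] n"]
        subgroup_nat_pow_closed[OF sU h(1)] by simp
    then show ?thesis using pi_element_lift[OF U(1) N(1,3) h(1) n(1)] h(2) by metis
  qed
  have torsion: "N #> u \<in> Q.pi_torsion \<sigma>" if u: "u \<in> U" "pi_element \<sigma> u" for u
  proof -
    obtain n where n: "pi_number \<sigma> n" "u [^] n \<in> N" using pi_element_pow[OF u(2) N(1)] by blast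
    have "(N #> u) [^]\<^bsub>?Q\<^esub> n = \<one>\<^bsub>?Q\<^esub>"
      using n(2) quotient_pow[OF U(1) N(1,3) u(1), of n] quotient_one[OF U(1) N(1,3), of "u [^] n"]
        subgroup_nat_pow_closed[OF sU u(1)] by simp
    then show ?thesis using n(1) u(1) quotient_carrier[OF U(1) N(1,3)] unfolding Q.pi_torsion_def by blast
  qed
  have "(N #> x) \<otimes>\<^bsub>?Q\<^esub> (N #> y) \<in> Q.pi_torsion \<sigma>"
  proof (rule Q.pi_torsion_mult_closed)
    show "finite (carrier ?Q)" using finite_quotient[OF U(1) N(1,3)] .
    show "c \<otimes>\<^bsub>?Q\<^esub> d = d \<otimes>\<^bsub>?Q\<^esub> c" if c: "c \<in> Q.pi_torsion \<sigma>" and d: "d \<in> Q.pi_torsion (- \<sigma>)" for c d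
    proof -
      obtain a where a: "a \<in> U" "pi_element \<sigma> a" "c = N #> a" using lift[OF c] by blast
      obtain b where b: "b \<in> U" "pi_element (- \<sigma>) b" "d = N #> b" using lift[OF d] by blast
      have "a \<otimes> b = b \<otimes> a" using sp a b unfolding pi_split_def by blast
      then show ?thesis
        using quotient_mult[OF U(1) N(1,3) a(1) b(1)] quotient_mult[OF U(1) N(1,3) b(1) a(1)] a b by metis
    qed
  qed (use torsion x y U(2) in auto)
  then obtain n where n: "pi_number \<sigma> n" "((N #> x) \<otimes>\<^bsub>?Q\<^esub> (N #> y)) [^]\<^bsub>?Q\<^esub> n = \<one>\<^bsub>?Q\<^esub>"
    unfolding Q.pi_torsion_def by blast
  have xy: "x \<otimes> y \<in> U" using U(2) sU by (simp add: subgroup.m_closed)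
  have "N #> ((x \<otimes> y) [^] n) = \<one>\<^bsub>?Q\<^esub>"
    using n(2) quotient_pow[OF U(1) N(1,3) xy, of n] quotient_mult[OF U(1) N(1,3), of x y] U(2) by simp
  then have "(x \<otimes> y) [^] n \<in> N"
    using quotient_one[OF U(1) N(1,3), of "(x \<otimes> y) [^] n"] subgroup_nat_pow_closed[OF sU xy] by blast
  then show "\<exists>n. pi_number \<sigma> n \<and> (x \<otimes> y) [^] n \<in> V" using n(1) N(2) by blast
qed

lemma pi_element_subgroup: "pi_split \<sigma> \<Longrightarrow> subgroup {g. pi_element \<sigma> g} G"
  by (rule subgroupI) (auto simp: pi_element_carrier pi_element_inv pi_element_mult intro: pi_element_one)

text \<open>The order of \<open>g\<close> modulo \<open>V\<close> divides an exponent of each type,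
  so its prime factors lie in every \<open>S j\<close>; one exponent serves the whole family, even
  an infinite one.\<close>

lemma pi_element_INT:
  assumes g: "g \<in> carrier G" and S: "\<And>j. j \<in> J \<Longrightarrow> pi_element (S j) g"
  shows "pi_element (\<Inter>j\<in>J. S j) g"
  unfolding pi_element_def
proof (intro conjI allI impI)
  fix V assume V: "open_subgroup V"
  obtain d :: nat where d: "d > 0" "\<forall>m::nat. g [^] m \<in> V \<longleftrightarrow> d dvd m"
    using order_modulo_open_subgroup[OF g V] .
  have "pi_number (S j) d" if j: "j \<in> J" for j
    using pi_element_pow[OF S[OF j] V] d(2) pi_number_dvd by blast
  then have "pi_number (\<Inter>j\<in>J. S j) d" using d(1) by (auto simp: pi_number_def)
  then show "\<exists>n. pi_number (\<Inter>j\<in>J. S j) n \<and> g [^] n \<in> V" using d by auto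
qed (rule g)

lemma pi_element_Compl:
  assumes "g \<in> carrier G" "\<And>p. p \<in> I \<Longrightarrow> pi_element (- {p}) g"
  shows "pi_element (- I) g"
proof -
  have "(\<Inter>p\<in>I. - {p}) = - I" by auto
  then show ?thesis using pi_element_INT[of g I "\<lambda>p. - {p}"] assms by simp
qed

text \<open>Peel off one prime: \<open>x\<close> is the product of a \<open>p\<close>-element and an
  element prime to \<open>p\<close> whose primes still lie in \<open>insert p P\<close>, hence in
  \<open>P\<close>. The \<open>p\<close>-element commutes with \<open>y\<close> because
  \<open>y\<close> is prime to \<open>I\<close>, in particular to \<open>p\<close>.\<close>

lemma finite_pi_split_commute:
  assumes sp: "\<And>p. p \<in> I \<Longrightarrow> pi_split {p}" and "finite P" "P \<subseteq> I" "pi_element P x" and y: "pi_element (- I) y"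
  shows "x \<otimes> y = y \<otimes> x"
  using assms(2-4)
proof (induction P arbitrary: x)
  case empty
  have "x = \<one>" using pi_element_disjoint[OF empty(2)] pi_element_mono[OF empty(2)] by blast
  then show ?case using pi_element_carrier[OF y] by simp
next
  case (insert p P)
  have x: "x \<in> carrier G" using insert.prems pi_element_carrier by blast
  obtain a b where ab: "b \<in> mono_closure G T x" "x = a \<otimes> b" "pi_element {p} a" "pi_element (- {p}) b"
    using pi_element_decomposition[OF x, of "{p}"] by metis
  have "pi_element (\<Inter>S\<in>{insert p P, - {p}}. S) b"
    using pi_element_mono_closure[OF insert.prems(2) ab(1)] ab(4) pi_element_carrier[OF ab(4)] by (intro pi_element_INT) auto
  then have "pi_element P b" by (rule pi_element_mono) auto
  then have "b \<otimes> y = y \<otimes> b" using insert.IH insert.prems by blast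
  moreover have "pi_element (- {p}) y" using insert.prems by (intro pi_element_mono[OF y]) auto
  then have "a \<otimes> y = y \<otimes> a" using sp[of p] insert.prems ab(3) unfolding pi_split_def by blast
  ultimately show ?case
    unfolding ab(2) using commute_mult pi_element_carrier[OF ab(3)] pi_element_carrier[OF ab(4)] pi_element_carrier[OF y] by blast
qed

text \<open>For infinite \<open>I\<close> the commutation is approximated: modulo \<open>N\<close>,
  \<open>x\<close> agrees with an element involving only the finitely many primes that divide an
  exponent of \<open>x\<close>. So \<open>finite_pi_split_commute\<close> puts the commutator of
  \<open>x\<close> and \<open>y\<close> into every open subgroup.\<close>

lemma pi_split_Union:
  assumes sp: "\<And>p. p \<in> I \<Longrightarrow> pi_split {p}"
  shows "pi_split I"
  unfolding pi_split_def
proof (intro allI impI)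
  fix x y assume x: "pi_element I x" and y: "pi_element (- I) y"
  have c: "x \<in> carrier G" "y \<in> carrier G" using x y pi_element_carrier by auto
  have "(x \<otimes> y) \<otimes> inv (y \<otimes> x) = \<one>"
  proof (rule eq_one_if_in_all_open_subgroup)
    fix V assume V: "open_subgroup V"
    obtain U where U: "compact_open U" "{x, y} \<subseteq> U" using compact_open_superset[of "{x, y}"] c by auto
    have "openin T V" "\<one> \<in> V" using V subgroup.one_closed by (auto simp: open_subgroup_def)
    from normal_neighbourhood[OF U(1) this] obtain N where N: "open_subgroup N" "N \<subseteq> V" "N \<lhd> (G\<lparr>carrier := U\<rparr>)" .
    obtain n where n: "pi_number I n" "x [^] n \<in> N" using pi_element_pow[OF x N(1)] by blast
    \<comment> \<open>\<open>P\<close> may contain composite divisors too; what counts is that it is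
      finite and contains all primes dividing \<open>n\<close>.\<close>
    define P where "P = {q \<in> I. q dvd n}"
    have P: "finite P" "P \<subseteq> I" "pi_number P n"
      using n(1) finite_divisors_nat[of n] by (auto simp: P_def pi_number_def)
    obtain a where a: "a \<in> U" "pi_element P a" "N #> x = N #> a"
      using pi_element_lift[OF U(1) N(1,3) _ P(3) n(2)] U(2) by auto
    have "a \<otimes> y = y \<otimes> a" by (rule finite_pi_split_commute[OF sp P(1,2) a(2) y])
    then have eq: "N #> (x \<otimes> y) = N #> (y \<otimes> x)"
      using quotient_mult[OF U(1) N(1,3), of x y] quotient_mult[OF U(1) N(1,3), of y x]
        quotient_mult[OF U(1) N(1,3), of a y] quotient_mult[OF U(1) N(1,3), of y a] a U(2) by simp
    have "x \<otimes> y \<in> N #> (y \<otimes> x)"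
      using rcos_self[OF _ open_subgroup_subgroup[OF N(1)], of "x \<otimes> y"] c unfolding eq by simp
    then obtain m where m: "m \<in> N" "x \<otimes> y = m \<otimes> (y \<otimes> x)" unfolding r_coset_def by blast
    have "m \<in> carrier G" using m N(1) open_subgroup_subgroup subgroup.mem_carrier by fast
    then have "(x \<otimes> y) \<otimes> inv (y \<otimes> x) = m"
      unfolding m(2) using c by (simp only: m_assoc m_closed inv_closed r_inv r_one)
    then show "(x \<otimes> y) \<otimes> inv (y \<otimes> x) \<in> V" using m(1) N(2) by auto
  qed (use c in simp)
  then have "(x \<otimes> y) \<otimes> inv (y \<otimes> x) \<otimes> (y \<otimes> x) = y \<otimes> x" using c by simp
  moreover have "(x \<otimes> y) \<otimes> inv (y \<otimes> x) \<otimes> (y \<otimes> x) = x \<otimes> y"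
    using c by (simp only: m_assoc m_closed inv_closed l_inv r_one)
  ultimately show "x \<otimes> y = y \<otimes> x" by simp
qed

section \<open>The projection onto the \<sigma>-part\<close>

text \<open>The choice is made inside the closure of the cyclic group of \<open>g\<close>, which
  keeps the projection in every open subgroup containing \<open>g\<close>. Uniqueness is not built
  in; under \<open>pi_split\<close>, \<open>pi_proj_unique\<close> reads the value off from any
  factorisation.\<close>

definition pi_proj :: "nat set \<Rightarrow> 'a \<Rightarrow> 'a" where
  "pi_proj \<sigma> g = (SOME a. a \<in> mono_closure G T g \<and> pi_element \<sigma> a \<and> pi_element (- \<sigma>) (inv a \<otimes> g))"

lemma pi_proj_spec:
  assumes g: "g \<in> carrier G"
  shows "pi_proj \<sigma> g \<in> mono_closure G T g \<and> pi_element \<sigma> (pi_proj \<sigma> g) \<and> pi_element (- \<sigma>) (inv (pi_proj \<sigma> g) \<otimes> g)"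
  unfolding pi_proj_def
proof (rule someI_ex)
  obtain a b where ab: "a \<in> mono_closure G T g" "g = a \<otimes> b" "pi_element \<sigma> a" "pi_element (- \<sigma>) b"
    using pi_element_decomposition[OF g, of \<sigma>] by metis
  have "inv a \<otimes> g = b" using ab pi_element_carrier[OF ab(3)] pi_element_carrier[OF ab(4)] by (simp add: m_assoc[symmetric])
  with ab show "\<exists>a. a \<in> mono_closure G T g \<and> pi_element \<sigma> a \<and> pi_element (- \<sigma>) (inv a \<otimes> g)" by metis
qed

lemma pi_element_pi_proj: "g \<in> carrier G \<Longrightarrow> pi_element \<sigma> (pi_proj \<sigma> g)"
  using pi_proj_spec by blast

lemma pi_proj_carrier: "g \<in> carrier G \<Longrightarrow> pi_proj \<sigma> g \<in> carrier G"
  using pi_element_pi_proj pi_element_carrier by blast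

lemma pi_proj_decomposition:
  assumes "g \<in> carrier G"
  obtains b where "pi_element (- \<sigma>) b" "g = pi_proj \<sigma> g \<otimes> b"
proof
  show "pi_element (- \<sigma>) (inv (pi_proj \<sigma> g) \<otimes> g)" using pi_proj_spec[OF assms] by blast
  show "g = pi_proj \<sigma> g \<otimes> (inv (pi_proj \<sigma> g) \<otimes> g)"
    using assms pi_proj_carrier[OF assms] by (simp add: m_assoc[symmetric])
qed

text \<open>Two factorisations of the same product differ by
  \<open>inv ?a \<otimes> a = b' \<otimes> inv b\<close>. Both kinds of elements are closed under
  products, so this is at once a \<sigma>-element and prime to \<sigma>, hence trivial.\<close>

lemma pi_proj_unique:
  assumes sp: "pi_split \<sigma>" and a: "pi_element \<sigma> a" and b: "pi_element (- \<sigma>) b"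
  shows "pi_proj \<sigma> (a \<otimes> b) = a"
proof -
  have c: "a \<in> carrier G" "b \<in> carrier G" using a b pi_element_carrier by auto
  let ?a = "pi_proj \<sigma> (a \<otimes> b)"
  obtain b' where b': "pi_element (- \<sigma>) b'" "a \<otimes> b = ?a \<otimes> b'" using pi_proj_decomposition[of "a \<otimes> b" \<sigma>] c by auto
  have c': "?a \<in> carrier G" "b' \<in> carrier G" using c pi_proj_carrier pi_element_carrier b'(1) by auto
  have "inv ?a \<otimes> a = inv ?a \<otimes> (a \<otimes> b) \<otimes> inv b" using c c' by (simp add: m_assoc)
  also have "\<dots> = inv ?a \<otimes> (?a \<otimes> b') \<otimes> inv b" by (simp only: b'(2)[symmetric])
  also have "\<dots> = b' \<otimes> inv b" using c c' by (simp add: m_assoc[symmetric])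
  finally have eq: "inv ?a \<otimes> a = b' \<otimes> inv b" .
  have "pi_element \<sigma> (inv ?a \<otimes> a)" using pi_element_mult[OF sp pi_element_inv[OF pi_element_pi_proj] a] c by simp
  moreover have "pi_element (- \<sigma>) (inv ?a \<otimes> a)"
    unfolding eq by (rule pi_element_mult[OF pi_split_Compl[OF sp] b'(1) pi_element_inv[OF b]])
  ultimately have "inv ?a \<otimes> a = \<one>" by (rule pi_element_disjoint)
  then have "?a \<otimes> (inv ?a \<otimes> a) = ?a" using c' by simp
  then show ?thesis using c c' by (simp add: m_assoc[symmetric])
qed

text \<open>When the factorisations of \<open>g\<close> and \<open>h\<close> are multiplied, the
  part of \<open>g\<close> prime to \<sigma> commutes past the \<sigma>-part of \<open>h\<close>;
  uniqueness then yields the \<sigma>-part of the product.\<close>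

lemma pi_proj_mult:
  assumes sp: "pi_split \<sigma>" and g: "g \<in> carrier G" and h: "h \<in> carrier G"
  shows "pi_proj \<sigma> (g \<otimes> h) = pi_proj \<sigma> g \<otimes> pi_proj \<sigma> h"
proof -
  obtain b where b: "pi_element (- \<sigma>) b" "g = pi_proj \<sigma> g \<otimes> b" using pi_proj_decomposition[OF g] .
  obtain d where d: "pi_element (- \<sigma>) d" "h = pi_proj \<sigma> h \<otimes> d" using pi_proj_decomposition[OF h] .
  have c: "pi_proj \<sigma> g \<in> carrier G" "pi_proj \<sigma> h \<in> carrier G" "b \<in> carrier G" "d \<in> carrier G"
    using g h pi_proj_carrier b d pi_element_carrier by auto
  have comm: "pi_proj \<sigma> h \<otimes> b = b \<otimes> pi_proj \<sigma> h" using sp pi_element_pi_proj[OF h] b(1) unfolding pi_split_def by blast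
  have "g \<otimes> h = (pi_proj \<sigma> g \<otimes> b) \<otimes> (pi_proj \<sigma> h \<otimes> d)" using b(2) d(2) by simp
  also have "\<dots> = pi_proj \<sigma> g \<otimes> (b \<otimes> pi_proj \<sigma> h) \<otimes> d" using c by (simp only: m_assoc m_closed)
  also have "\<dots> = pi_proj \<sigma> g \<otimes> (pi_proj \<sigma> h \<otimes> b) \<otimes> d" by (simp only: comm)
  also have "\<dots> = (pi_proj \<sigma> g \<otimes> pi_proj \<sigma> h) \<otimes> (b \<otimes> d)" using c by (simp only: m_assoc m_closed)
  finally have eq: "g \<otimes> h = (pi_proj \<sigma> g \<otimes> pi_proj \<sigma> h) \<otimes> (b \<otimes> d)" .
  show ?thesis
    unfolding eq
    by (rule pi_proj_unique[OF sp pi_element_mult[OF sp pi_element_pi_proj[OF g] pi_element_pi_proj[OF h]] pi_element_mult[OF pi_split_Compl[OF sp] b(1) d(1)]])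
qed

lemma pi_proj_in_open_subgroup: "open_subgroup V \<Longrightarrow> g \<in> V \<Longrightarrow> pi_proj \<sigma> g \<in> V"
  using pi_proj_spec mono_closure_subset_open_subgroup subgroup.mem_carrier[OF open_subgroup_subgroup] by blast

lemma pi_proj_fix: "pi_split \<sigma> \<Longrightarrow> pi_element \<sigma> g \<Longrightarrow> pi_proj \<sigma> g = g"
  using pi_proj_unique[of \<sigma> g \<one>] pi_element_one pi_element_carrier by simp

lemma pi_proj_kill: "pi_split \<sigma> \<Longrightarrow> pi_element (- \<sigma>) g \<Longrightarrow> pi_proj \<sigma> g = \<one>"
  using pi_proj_unique[of \<sigma> \<one> g] pi_element_one pi_element_carrier by simp

lemma pi_proj_eq_one: "g \<in> carrier G \<Longrightarrow> pi_proj \<sigma> g = \<one> \<Longrightarrow> pi_element (- \<sigma>) g"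
  using pi_proj_spec[of g \<sigma>] by simp

lemma pi_proj_continuous:
  assumes sp: "pi_split \<sigma>"
  shows "continuous_map T T (pi_proj \<sigma>)"
  unfolding continuous_map_def
proof (intro conjI allI impI)
  show "pi_proj \<sigma> \<in> topspace T \<rightarrow> topspace T" using pi_proj_carrier by (simp add: topspace_eq)
  fix S assume S: "openin T S"
  show "openin T {x \<in> topspace T. pi_proj \<sigma> x \<in> S}"
  proof (subst openin_subopen, intro ballI)
    fix x assume "x \<in> {x \<in> topspace T. pi_proj \<sigma> x \<in> S}"
    then have x: "x \<in> carrier G" "pi_proj \<sigma> x \<in> S" by (auto simp: topspace_eq)
    let ?W = "{w \<in> topspace T. pi_proj \<sigma> x \<otimes> w \<in> S}"
    have "openin T ?W"
      by (rule openin_continuous_map_preimage[OF continuous_map_translate(1)[OF pi_proj_carrier[OF x(1)]] S])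
    moreover have "\<one> \<in> ?W" using x pi_proj_carrier by (simp add: topspace_eq)
    ultimately obtain V where V: "open_subgroup V" "V \<subseteq> ?W" using open_subgroup_neighbourhood by metis
    let ?O = "(\<lambda>v. x \<otimes> v) ` V"
    have "openin T ?O" using open_left_translate[OF x(1)] V(1) by (simp add: open_subgroup_def)
    moreover have "x \<in> ?O" using self_in_left_coset[OF V(1) x(1)] .
    moreover have "?O \<subseteq> {x \<in> topspace T. pi_proj \<sigma> x \<in> S}"
    proof
      fix y assume "y \<in> ?O"
      then obtain v where v: "v \<in> V" "y = x \<otimes> v" by blast
      have vc: "v \<in> carrier G" using v V(1) open_subgroup_subgroup subgroup.mem_carrier by fast
      have "pi_proj \<sigma> y = pi_proj \<sigma> x \<otimes> pi_proj \<sigma> v" using pi_proj_mult[OF sp x(1) vc] v by simp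
      then show "y \<in> {x \<in> topspace T. pi_proj \<sigma> x \<in> S}"
        using pi_proj_in_open_subgroup[OF V(1) v(1)] V(2) v x vc by (auto simp: topspace_eq)
    qed
    ultimately show "\<exists>R. openin T R \<and> x \<in> R \<and> R \<subseteq> {x \<in> topspace T. pi_proj \<sigma> x \<in> S}"
      by (intro exI[of _ ?O]) auto
  qed
qed


section \<open>The decomposition\<close>

lemma topological_group_subgroup:
  assumes H: "subgroup H G"
  shows "topological_group (G\<lparr>carrier := H\<rparr>) (subtopology T H)"
  unfolding topological_group_def
proof (intro conjI)
  let ?X = "subtopology T H"
  have Hc: "H \<subseteq> carrier G" using H subgroup.subset by blast
  show "group (G\<lparr>carrier := H\<rparr>)" by (rule subgroup_imp_group[OF H])
  show ts: "topspace ?X = carrier (G\<lparr>carrier := H\<rparr>)" using Hc by (auto simp: topspace_eq)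
  have "continuous_map (subtopology (prod_topology T T) (H \<times> H)) T (\<lambda>(x, y). x \<otimes> y)"
    by (rule continuous_map_from_subtopology[OF continuous_mult])
  then have "continuous_map (prod_topology ?X ?X) T (\<lambda>(x, y). x \<otimes> y)"
    by (simp add: subtopology_Times)
  then have "continuous_map (prod_topology ?X ?X) ?X (\<lambda>(x, y). x \<otimes> y)"
    using H by (intro continuous_map_into_subtopology) (auto simp: subgroup.m_closed)
  then show "continuous_map (prod_topology ?X ?X) ?X (\<lambda>(x, y). x \<otimes>\<^bsub>G\<lparr>carrier := H\<rparr>\<^esub> y)" by simp
  have "continuous_map ?X ?X (m_inv G)"
    using H continuous_map_from_subtopology[OF continuous_inv]
    by (intro continuous_map_into_subtopology) (auto simp: subgroup.m_inv_closed)
  then show "continuous_map ?X ?X (m_inv (G\<lparr>carrier := H\<rparr>))"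
    by (rule continuous_map_eq) (use H in \<open>auto simp: m_inv_consistent\<close>)
qed

section \<open>The map formed by all projections\<close>

context
  fixes I :: "nat set" and U :: "'a set"
  assumes sp: "\<And>p. p \<in> I \<Longrightarrow> pi_split {p}" and U: "compact_open U"
begin

abbreviation "Gs \<equiv> (\<lambda>p. G\<lparr>carrier := {g. pi_element {p} g}\<rparr>)"
abbreviation "Xs \<equiv> (\<lambda>p. subtopology T {g. pi_element {p} g})"
abbreviation "Us \<equiv> (\<lambda>p. U \<inter> {g. pi_element {p} g})"

definition coords :: "'a \<Rightarrow> nat \<Rightarrow> 'a" where
  "coords g = (\<lambda>p\<in>I. pi_proj {p} g)"

definition factors :: "'a \<Rightarrow> 'a \<times> (nat \<Rightarrow> 'a)" where
  "factors g = (pi_proj (- I) g, coords g)"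

lemma pi_split_Compl_I: "pi_split (- I)"
  using pi_split_Compl[OF pi_split_Union] sp by blast

lemma U_subgroup: "subgroup U G" and U_compact: "compactin T U" and U_open: "openin T U"
  using U by (auto simp: compact_open_subgroup_def)

lemma U_carrier: "U \<subseteq> carrier G"
  using subgroup.subset[OF U_subgroup] .

lemma Us_subgroup: "p \<in> I \<Longrightarrow> subgroup (Us p) G"
  by (rule subgroups_Inter_pair[OF U_subgroup pi_element_subgroup[OF sp]])

lemma local_product_components: "local_product I Gs Xs Us"
proof (rule local_product.intro)
  fix p assume p: "p \<in> I"
  show "topological_group (Gs p) (Xs p)" by (rule topological_group_subgroup[OF pi_element_subgroup[OF sp[OF p]]])
  show "subgroup (Us p) (Gs p)"
    by (rule subgroup_incl[OF Us_subgroup[OF p] pi_element_subgroup[OF sp[OF p]]]) simp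
qed

interpretation L: local_product I Gs Xs Us
  by (rule local_product_components)

lemma PG_mult: "x \<otimes>\<^bsub>product_group I Gs\<^esub> y = (\<lambda>p\<in>I. x p \<otimes> y p)"
  by simp

lemma pi_proj_pow_in_open_subgroup:
  "g \<in> carrier G \<Longrightarrow> open_subgroup V \<Longrightarrow> g [^] (n::nat) \<in> V \<Longrightarrow> pi_proj \<sigma> g [^] n \<in> V"
  using mono_closure_pow_in pi_proj_spec by blast

text \<open>Let \<open>n\<close> be an exponent of \<open>g\<close> modulo \<open>U\<close>. If
  \<open>p\<close> does not divide \<open>n\<close>, the \<open>p\<close>-part has modulo
  \<open>U\<close> both the exponent \<open>n\<close> and one that is a \<open>{p}\<close>-number,
  so it lies in \<open>U\<close>; only divisors of \<open>n\<close> can be exceptional.\<close>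

lemma coords_in_LPC:
  assumes g: "g \<in> carrier G"
  shows "coords g \<in> loc_prod_carrier I Gs Us"
proof -
  obtain n :: nat where n: "n > 0" "g [^] n \<in> U" using open_subgroup_pow_exists[OF g compact_open_imp_open_subgroup[OF U]] .
  have "{p \<in> I. coords g p \<notin> Us p} \<subseteq> {p. p dvd n}"
  proof
    fix p assume "p \<in> {p \<in> I. coords g p \<notin> Us p}"
    then have p: "p \<in> I" "pi_proj {p} g \<notin> U" using pi_element_pi_proj[OF g] by (auto simp: coords_def)
    show "p \<in> {p. p dvd n}"
    proof (rule ccontr)
      assume "p \<notin> {p. p dvd n}"
      then have pn: "pi_number (- {p}) n" using n(1) by (auto simp: pi_number_def)
      obtain k where k: "pi_number {p} k" "pi_proj {p} g [^] k \<in> U"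
        using pi_element_pow[OF pi_element_pi_proj[OF g] compact_open_imp_open_subgroup[OF U]] by blast
      have "pi_proj {p} g \<in> U"
        by (rule coprime_pow_in_subgroup[OF U_subgroup pi_proj_carrier[OF g] pi_number_coprime[OF k(1) pn] k(2)
            pi_proj_pow_in_open_subgroup[OF g compact_open_imp_open_subgroup[OF U] n(2)]])
      with p(2) show False ..
    qed
  qed
  moreover have "finite {p. p dvd n}" using finite_divisors_nat n(1) by blast
  ultimately have "finite {p \<in> I. coords g p \<notin> Us p}" using finite_subset by blast
  then show ?thesis using pi_element_pi_proj[OF g] by (auto simp: loc_prod_carrier_def coords_def)
qed

lemma coords_in_PiE: "g \<in> U \<Longrightarrow> coords g \<in> Pi\<^sub>E I Us"
  using pi_proj_in_open_subgroup[OF compact_open_imp_open_subgroup[OF U]] pi_element_pi_proj U_carrier by (auto simp: coords_def)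

lemma coords_mult:
  assumes "g \<in> carrier G" "h \<in> carrier G"
  shows "coords (g \<otimes> h) = coords g \<otimes>\<^bsub>product_group I Gs\<^esub> coords h"
  unfolding PG_mult using assms pi_proj_mult[OF sp] by (auto simp: coords_def)

text \<open>All projections of \<open>inv g \<otimes> h\<close> are trivial. Triviality at each
  \<open>p \<in> I\<close> makes it prime to all of \<open>I\<close> at once
  (\<open>pi_element_Compl\<close>), so it equals its own projection for \<open>- I\<close>, which
  is trivial as well.\<close>

lemma factors_inj: "inj_on factors (carrier G)"
proof (rule inj_onI)
  fix g h assume g: "g \<in> carrier G" and h: "h \<in> carrier G" and eq: "factors g = factors h"
  let ?k = "inv g \<otimes> h"
  have k: "?k \<in> carrier G" using g h by simp
  have one: "pi_proj \<sigma> ?k = \<one>" if s: "pi_split \<sigma>" and e: "pi_proj \<sigma> g = pi_proj \<sigma> h" for \<sigma>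
  proof -
    have "g \<otimes> ?k = h" using g h by (simp add: m_assoc[symmetric])
    then have "pi_proj \<sigma> g \<otimes> pi_proj \<sigma> ?k = pi_proj \<sigma> g"
      using pi_proj_mult[OF s g k] e by simp
    then show ?thesis using l_cancel_one[OF pi_proj_carrier[OF g] pi_proj_carrier[OF k]] by simp
  qed
  have "pi_proj {p} ?k = \<one>" if p: "p \<in> I" for p
  proof (rule one[OF sp[OF p]])
    have "coords g p = coords h p" using eq by (simp add: factors_def)
    then show "pi_proj {p} g = pi_proj {p} h" using p by (simp add: coords_def)
  qed
  then have "pi_element (- I) ?k" using pi_element_Compl[OF k] pi_proj_eq_one[OF k] by blast
  moreover have "pi_proj (- I) ?k = \<one>" using one[OF pi_split_Compl_I] eq by (simp add: factors_def)
  ultimately have "?k = \<one>" using pi_proj_fix[OF pi_split_Compl_I] by simp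
  then have "g \<otimes> ?k = g" using g by simp
  then show "g = h" using g h by (simp add: m_assoc[symmetric])
qed

text \<open>Multiplication by \<open>f q\<close> changes the \<open>q\<close>-coordinate alone,
  since the other projections are multiplicative and kill \<open>f q\<close>. The value \<one>
  outside \<open>P\<close> marks the coordinates not yet prescribed.\<close>

lemma finite_coords_exist:
  assumes W: "subgroup W G" and h: "h \<in> W" "pi_element (- I) h" and f: "\<And>p. p \<in> I \<Longrightarrow> f p \<in> W \<and> pi_element {p} (f p)"
    and "finite P" "P \<subseteq> I"
  shows "\<exists>g\<in>W. pi_proj (- I) g = h \<and> (\<forall>p\<in>I. pi_proj {p} g = (if p \<in> P then f p else \<one>))"
  using assms(5,6)
proof (induction P)
  case empty
  have "pi_proj {p} h = \<one>" if p: "p \<in> I" for p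
    using pi_proj_kill[OF sp[OF p]] pi_element_mono[OF h(2), of "- {p}"] p by blast
  then show ?case using h pi_proj_fix[OF pi_split_Compl_I h(2)] by auto
next
  case (insert q P)
  then obtain g where g: "g \<in> W" "pi_proj (- I) g = h" "\<And>p. p \<in> I \<Longrightarrow> pi_proj {p} g = (if p \<in> P then f p else \<one>)"
    by auto
  have q: "q \<in> I" using insert.prems by blast
  have fq: "f q \<in> W" "pi_element {q} (f q)" using f[OF q] by auto
  have c: "g \<in> carrier G" "f q \<in> carrier G" using g(1) fq(1) subgroup.mem_carrier[OF W] by auto
  have hc: "h \<in> carrier G" using pi_element_carrier[OF h(2)] .
  have "pi_element (- (- I)) (f q)" using pi_element_mono[OF fq(2)] q by simp
  then have "pi_proj (- I) (f q) = \<one>" by (rule pi_proj_kill[OF pi_split_Compl_I])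
  then have "pi_proj (- I) (g \<otimes> f q) = h" using pi_proj_mult[OF pi_split_Compl_I c] g(2) hc by simp
  moreover have "pi_proj {p} (g \<otimes> f q) = (if p \<in> insert q P then f p else \<one>)" if p: "p \<in> I" for p
  proof -
    have eq: "pi_proj {p} (g \<otimes> f q) = pi_proj {p} g \<otimes> pi_proj {p} (f q)" by (rule pi_proj_mult[OF sp[OF p] c])
    show ?thesis
    proof (cases "p = q")
      case True
      then show ?thesis using eq g(3)[OF p] insert.hyps pi_proj_fix[OF sp[OF q] fq(2)] c by simp
    next
      case False
      have "pi_element (- {p}) (f q)" by (rule pi_element_mono[OF fq(2)]) (use False in auto)
      then have "pi_proj {p} (f q) = \<one>" by (rule pi_proj_kill[OF sp[OF p]])
      then show ?thesis using eq g(3)[OF p] False pi_proj_carrier[OF c(1), of "{p}"] by auto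
    qed
  qed
  moreover have "g \<otimes> f q \<in> W" using g(1) fq(1) W by (simp add: subgroup.m_closed)
  ultimately show ?case by blast
qed

text \<open>Each coordinate prescribes the value of a continuous projection, so its solutions form a
  closed set. Finitely many prescriptions are solvable inside \<open>W\<close>, and compactness of
  \<open>W\<close> solves all of them together.\<close>

lemma coords_exist:
  assumes W: "compact_open W" and h: "h \<in> W" "pi_element (- I) h" and f: "\<And>p. p \<in> I \<Longrightarrow> f p \<in> W \<and> pi_element {p} (f p)"
  obtains g where "g \<in> W" "pi_proj (- I) g = h" "\<forall>p\<in>I. pi_proj {p} g = f p"
proof -
  have W': "subgroup W G" "compactin T W" using W by (auto simp: compact_open_subgroup_def)
  define D0 where "D0 = {g \<in> topspace T. pi_proj (- I) g = h}"
  define D where "D p = {g \<in> topspace T. pi_proj {p} g = f p}" for p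
  have D0c: "closedin T D0"
    unfolding D0_def
    by (rule closedin_continuous_maps_eq[OF Hausdorff pi_proj_continuous[OF pi_split_Compl_I]])
       (use pi_element_carrier[OF h(2)] in \<open>simp add: topspace_eq\<close>)
  have Dc: "closedin T (D p)" if "p \<in> I" for p
    unfolding D_def
    by (rule closedin_continuous_maps_eq[OF Hausdorff pi_proj_continuous[OF sp[OF that]]])
       (use f[OF that] pi_element_carrier in \<open>auto simp: topspace_eq\<close>)
  have "W \<inter> \<Inter>(insert D0 (D ` I)) \<noteq> {}"
  proof -
    have "W \<inter> \<Inter>\<F> \<noteq> {}" if \<F>: "finite \<F>" "\<F> \<subseteq> insert D0 (D ` I)" for \<F>
    proof -
      have "finite (\<F> - {D0})" "\<F> - {D0} \<subseteq> D ` I" using \<F> by auto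
      then obtain P where P: "P \<subseteq> I" "finite P" "\<F> - {D0} = D ` P" using finite_subset_image by metis
      obtain g where g: "g \<in> W" "pi_proj (- I) g = h" "\<forall>p\<in>I. pi_proj {p} g = (if p \<in> P then f p else \<one>)"
        using finite_coords_exist[OF W'(1) h f P(2,1)] by blast
      have gc: "g \<in> topspace T" using g(1) subgroup.mem_carrier[OF W'(1)] by (simp add: topspace_eq)
      have "g \<in> D p" if "p \<in> P" for p using gc g(3) that P(1) by (auto simp: D_def)
      moreover have "g \<in> D0" using gc g(2) by (simp add: D0_def)
      ultimately have "g \<in> \<Inter>\<F>" using P(3) by blast
      then show ?thesis using g(1) by blast
    qed
    moreover have "\<forall>C\<in>insert D0 (D ` I). closedin T C" using D0c Dc by auto
    ultimately show ?thesis using W'(2) unfolding compactin_fip by blast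
  qed
  then obtain g where "g \<in> W" "g \<in> D0" "\<forall>p\<in>I. g \<in> D p" by blast
  then show thesis using that by (auto simp: D0_def D_def)
qed

text \<open>The finitely many coordinates outside \<open>Us\<close>, together with \<open>h\<close>,
  fit into one compact open \<open>W\<close> containing \<open>U\<close>; all other coordinates are
  in \<open>U\<close> already, so \<open>coords_exist\<close> applies in \<open>W\<close>.\<close>

lemma factors_surj:
  assumes h: "pi_element (- I) h" and f: "f \<in> loc_prod_carrier I Gs Us"
  obtains g where "g \<in> carrier G" "factors g = (h, f)"
proof -
  have fin: "finite {p \<in> I. f p \<notin> Us p}" and fs: "\<And>p. p \<in> I \<Longrightarrow> pi_element {p} (f p)" and ext: "f \<in> extensional I"
    using f by (auto simp: loc_prod_carrier_def PiE_def Pi_def)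
  have fin': "finite (insert h (f ` {p \<in> I. f p \<notin> Us p}))" using fin by blast
  have sub': "insert h (f ` {p \<in> I. f p \<notin> Us p}) \<subseteq> carrier G" using fs h pi_element_carrier by blast
  obtain W where W: "compact_open W" "U \<subseteq> W" "insert h (f ` {p \<in> I. f p \<notin> Us p}) \<subseteq> W"
    by (rule compact_open_finite_superset[OF fin' sub' U])
  have fW: "f p \<in> W \<and> pi_element {p} (f p)" if "p \<in> I" for p
    using W(2,3) fs[OF that] that by (cases "f p \<in> Us p") auto
  have hW: "h \<in> W" using W(3) by simp
  obtain g where g: "g \<in> W" "pi_proj (- I) g = h" "\<forall>p\<in>I. pi_proj {p} g = f p"
    by (rule coords_exist[OF W(1) hW h fW])
  have "coords g = f" using g(3) ext by (auto simp: coords_def extensional_def)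
  then show thesis
    using that[of g] g subgroup.mem_carrier[OF open_subgroup_subgroup[OF compact_open_imp_open_subgroup[OF W(1)]]] by (simp add: factors_def)
qed

lemma factors_image: "factors ` carrier G = {g. pi_element (- I) g} \<times> loc_prod_carrier I Gs Us"
proof
  show "factors ` carrier G \<subseteq> {g. pi_element (- I) g} \<times> loc_prod_carrier I Gs Us"
    using coords_in_LPC pi_element_pi_proj by (auto simp: factors_def)
  show "{g. pi_element (- I) g} \<times> loc_prod_carrier I Gs Us \<subseteq> factors ` carrier G"
  proof safe
    fix h f assume "pi_element (- I) h" "f \<in> loc_prod_carrier I Gs Us"
    then obtain g where "g \<in> carrier G" "factors g = (h, f)" by (rule factors_surj)
    then show "(h, f) \<in> factors ` carrier G" by (intro image_eqI[of _ _ g]) simp_all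
  qed
qed

lemma factors_iso:
  "factors \<in> iso G (G\<lparr>carrier := {g. pi_element (- I) g}\<rparr> \<times>\<times> loc_prod_group I Gs Us)"
proof (rule isoI)
  show "factors \<in> hom G (G\<lparr>carrier := {g. pi_element (- I) g}\<rparr> \<times>\<times> loc_prod_group I Gs Us)"
  proof (rule homI)
    fix g assume "g \<in> carrier G"
    then have "factors g \<in> {g. pi_element (- I) g} \<times> loc_prod_carrier I Gs Us" using factors_image by blast
    then show "factors g \<in> carrier (G\<lparr>carrier := {g. pi_element (- I) g}\<rparr> \<times>\<times> loc_prod_group I Gs Us)"
      by (simp add: DirProd_def loc_prod_group_def)
  next
    fix g h assume "g \<in> carrier G" "h \<in> carrier G"
    then show "factors (g \<otimes> h) =
      factors g \<otimes>\<^bsub>G\<lparr>carrier := {g. pi_element (- I) g}\<rparr> \<times>\<times> loc_prod_group I Gs Us\<^esub> factors h"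
      using pi_proj_mult[OF pi_split_Compl_I] coords_mult by (simp add: factors_def DirProd_def loc_prod_group_def)
  qed
  show "bij_betw factors (carrier G) (carrier (G\<lparr>carrier := {g. pi_element (- I) g}\<rparr> \<times>\<times> loc_prod_group I Gs Us))"
    using factors_inj factors_image by (simp add: bij_betw_def DirProd_def loc_prod_group_def)
qed

section \<open>Continuity and openness of this map\<close>

lemma subtopology_Us: "subtopology (Xs p) (Us p) = subtopology T (Us p)"
proof -
  have "{g. pi_element {p} g} \<inter> Us p = Us p" by blast
  then show ?thesis by (simp only: subtopology_subtopology)
qed

lemma coords_continuous_U: "continuous_map (subtopology T U) L.PT coords"
  unfolding continuous_map_componentwise
proof (intro conjI ballI)
  show "coords ` topspace (subtopology T U) \<subseteq> extensional I" by (auto simp: coords_def)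
  fix p assume p: "p \<in> I"
  have "continuous_map (subtopology T U) (subtopology T (Us p)) (pi_proj {p})"
    using continuous_map_from_subtopology[OF pi_proj_continuous[OF sp[OF p]]]
      pi_proj_in_open_subgroup[OF compact_open_imp_open_subgroup[OF U]] pi_element_pi_proj
    by (intro continuous_map_into_subtopology) (auto simp: topspace_eq)
  then show "continuous_map (subtopology T U) (subtopology (Xs p) (Us p)) (\<lambda>g. coords g p)"
    unfolding subtopology_Us using p by (simp add: coords_def)
qed

text \<open>Near \<open>g\<close> the map is \<open>coords\<close> on \<open>U\<close>, with values
  in an ordinary product topology, followed by translation by \<open>coords g\<close>; the open sets
  of the local product are defined by exactly this test.\<close>

lemma coords_continuous: "continuous_map T L.LPT coords"
  unfolding continuous_map_def
proof (intro conjI allI impI)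
  show "coords \<in> topspace T \<rightarrow> topspace L.LPT"
    using coords_in_LPC unfolding L.topspace_LPT topspace_eq by blast
  fix S assume S: "openin L.LPT S"
  show "openin T {g \<in> topspace T. coords g \<in> S}"
  proof (subst openin_subopen, intro ballI)
    fix g assume "g \<in> {g \<in> topspace T. coords g \<in> S}"
    then have g: "g \<in> carrier G" "coords g \<in> S" by (auto simp: topspace_eq)
    let ?S = "{u \<in> Pi\<^sub>E I Us. coords g \<otimes>\<^bsub>product_group I Gs\<^esub> u \<in> S}"
    have "openin L.PT ?S" using S g(2) unfolding L.openin_LPT L.lopen_def by blast
    then have "openin (subtopology T U) {v \<in> topspace (subtopology T U). coords v \<in> ?S}"
      by (rule openin_continuous_map_preimage[OF coords_continuous_U])
    moreover have "topspace (subtopology T U) = U" using U_carrier by (auto simp: topspace_eq)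
    ultimately have "openin (subtopology T U) {v \<in> U. coords v \<in> ?S}" by (simp only:)
    then have "openin T {v \<in> U. coords v \<in> ?S}" by (rule openin_trans_full[OF _ U_open])
    then have "openin T ((\<lambda>v. g \<otimes> v) ` {v \<in> U. coords v \<in> ?S})" by (rule open_left_translate[OF g(1)])
    moreover have "g \<in> (\<lambda>v. g \<otimes> v) ` {v \<in> U. coords v \<in> ?S}"
    proof (rule image_eqI[of _ _ \<one>])
      show "g = g \<otimes> \<one>" using g by simp
      have "coords g \<otimes>\<^bsub>product_group I Gs\<^esub> coords \<one> = coords g" using coords_mult[OF g(1) one_closed] g(1) by simp
      then show "\<one> \<in> {v \<in> U. coords v \<in> ?S}"
        using g(2) coords_in_PiE[OF subgroup.one_closed[OF U_subgroup]] subgroup.one_closed[OF U_subgroup]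
        by (simp del: mult_product_group)
    qed
    moreover have "(\<lambda>v. g \<otimes> v) ` {v \<in> U. coords v \<in> ?S} \<subseteq> {g \<in> topspace T. coords g \<in> S}"
    proof
      fix y assume "y \<in> (\<lambda>v. g \<otimes> v) ` {v \<in> U. coords v \<in> ?S}"
      then obtain v where v: "v \<in> U" "coords v \<in> ?S" "y = g \<otimes> v" by blast
      have vc: "v \<in> carrier G" using v(1) U_carrier by blast
      have "coords y \<in> S" unfolding v(3) coords_mult[OF g(1) vc] using v(2) by blast
      then show "y \<in> {g \<in> topspace T. coords g \<in> S}" using v(3) g(1) vc by (simp add: topspace_eq)
    qed
    ultimately show "\<exists>R. openin T R \<and> g \<in> R \<and> R \<subseteq> {g \<in> topspace T. coords g \<in> S}" by blast
  qed
qed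

text \<open>A continuous bijection from a compact space to a Hausdorff space. That the image is the
  whole product comes from \<open>coords_exist\<close> with \<open>W = U\<close>.\<close>

lemma factors_homeomorphic_U:
  "homeomorphic_map (subtopology T U)
     (prod_topology (subtopology T (U \<inter> {g. pi_element (- I) g})) L.PT) factors"
proof (rule continuous_imp_homeomorphic_map)
  let ?X = "subtopology T U" and ?H = "subtopology T (U \<inter> {g. pi_element (- I) g})"
  have tU: "topspace ?X = U" using U_carrier by (auto simp: topspace_eq)
  have tH: "topspace ?H = U \<inter> {g. pi_element (- I) g}" using U_carrier by (auto simp: topspace_eq)
  have prU: "pi_proj (- I) v \<in> U \<inter> {g. pi_element (- I) g}" if "v \<in> U" for v
    using that pi_proj_in_open_subgroup[OF compact_open_imp_open_subgroup[OF U]] pi_element_pi_proj U_carrier by blast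
  have "continuous_map ?X ?H (pi_proj (- I))"
    using continuous_map_from_subtopology[OF pi_proj_continuous[OF pi_split_Compl_I]] prU
    by (intro continuous_map_into_subtopology) auto
  then show "continuous_map ?X (prod_topology ?H L.PT) factors"
    unfolding factors_def[abs_def] by (rule continuous_map_pairedI[OF _ coords_continuous_U])
  show "compact_space ?X" using U_compact compact_space_subtopology by blast
  have "Hausdorff_space L.PT"
    unfolding Hausdorff_space_product_topology using Hausdorff Hausdorff_space_subtopology by blast
  then show "Hausdorff_space (prod_topology ?H L.PT)"
    unfolding Hausdorff_space_prod_topology using Hausdorff Hausdorff_space_subtopology by blast
  show "inj_on factors (topspace ?X)"
    unfolding tU using factors_inj U_carrier inj_on_subset by blast
  show "factors ` topspace ?X = topspace (prod_topology ?H L.PT)"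
    unfolding tU topspace_prod_topology tH L.topspace_PT
  proof
    show "factors ` U \<subseteq> (U \<inter> {g. pi_element (- I) g}) \<times> Pi\<^sub>E I Us"
      unfolding factors_def using prU coords_in_PiE by blast
    show "(U \<inter> {g. pi_element (- I) g}) \<times> Pi\<^sub>E I Us \<subseteq> factors ` U"
    proof
      fix z assume z: "z \<in> (U \<inter> {g. pi_element (- I) g}) \<times> Pi\<^sub>E I Us"
      obtain h f where hf: "z = (h, f)" by (cases z)
      have f: "f p \<in> U \<and> pi_element {p} (f p)" if "p \<in> I" for p using z that unfolding hf by auto
      have h: "h \<in> U" "pi_element (- I) h" using z unfolding hf by auto
      obtain g where g: "g \<in> U" "pi_proj (- I) g = h" "\<forall>p\<in>I. pi_proj {p} g = f p"
        by (rule coords_exist[OF U h f])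
      have "f \<in> extensional I" using z unfolding hf by (auto simp: PiE_def)
      then have "coords g = f" using g(3) by (auto simp: coords_def extensional_def)
      then show "z \<in> factors ` U" using g hf by (auto simp: factors_def)
    qed
  qed
qed

text \<open>Homogeneity reduces openness at \<open>g\<close> to openness at \<one>: the part of
  \<open>B\<close> near \<open>g\<close> is translated back into \<open>U\<close>, mapped by the
  homeomorphism on \<open>U\<close>, and moved forward by the two components of
  \<open>factors g\<close>.\<close>

lemma factors_open_map: "open_map T (prod_topology (subtopology T {g. pi_element (- I) g}) L.LPT) factors"
  unfolding open_map_def
proof (intro allI impI)
  fix B assume B: "openin T B"
  let ?H = "{g. pi_element (- I) g}"
  have tU: "topspace (subtopology T U) = U" using U_carrier by (auto simp: topspace_eq)
  show "openin (prod_topology (subtopology T ?H) L.LPT) (factors ` B)"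
    unfolding openin_prod_topology_alt
  proof (intro allI impI)
    fix x y assume "(x, y) \<in> factors ` B"
    then obtain g where g: "g \<in> B" "x = pi_proj (- I) g" "y = coords g" by (auto simp: factors_def)
    have gc: "g \<in> carrier G" using g(1) open_subset_carrier[OF B] by blast
    have xc: "x \<in> carrier G" "pi_element (- I) x" using g(2) pi_proj_carrier[OF gc] pi_element_pi_proj[OF gc] by auto
    have y: "y \<in> L.LPC" unfolding g(3) by (rule coords_in_LPC[OF gc])
    let ?S = "{v \<in> topspace (subtopology T U). g \<otimes> v \<in> B}"
    have "openin (subtopology T U) ?S"
      by (rule openin_continuous_map_preimage[OF continuous_map_from_subtopology[OF continuous_map_translate(1)[OF gc]] B])
    then have "openin (prod_topology (subtopology T (U \<inter> ?H)) L.PT) (factors ` ?S)"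
      using homeomorphic_imp_open_map[OF factors_homeomorphic_U] unfolding open_map_def by blast
    moreover have "\<one> \<in> ?S" unfolding tU using g(1) gc subgroup.one_closed[OF U_subgroup] by simp
    then have "(pi_proj (- I) \<one>, coords \<one>) \<in> factors ` ?S" unfolding factors_def by blast
    ultimately obtain A C where AC: "openin (subtopology T (U \<inter> ?H)) A" "openin L.PT C"
      "pi_proj (- I) \<one> \<in> A" "coords \<one> \<in> C" "A \<times> C \<subseteq> factors ` ?S"
      unfolding openin_prod_topology_alt by meson
    obtain A0 where A0: "openin T A0" "A = A0 \<inter> (U \<inter> ?H)" using AC(1) unfolding openin_subtopology by blast
    have sH: "subgroup ?H G" by (rule pi_element_subgroup[OF pi_split_Compl_I])
    let ?A = "(\<lambda>a. x \<otimes> a) ` A"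
    \<comment> \<open>\<open>A\<close> is open relative to \<open>U \<inter> ?H\<close>. Since
      \<open>x\<close> lies in the subgroup \<open>?H\<close>, its translate is the trace on
      \<open>?H\<close> of an open set of the whole group.\<close>
    have "?A = ?H \<inter> (\<lambda>a. x \<otimes> a) ` (A0 \<inter> U)"
    proof
      show "?A \<subseteq> ?H \<inter> (\<lambda>a. x \<otimes> a) ` (A0 \<inter> U)"
        using A0(2) subgroup.m_closed[OF sH] xc(2) by auto
      show "?H \<inter> (\<lambda>a. x \<otimes> a) ` (A0 \<inter> U) \<subseteq> ?A"
      proof
        fix w assume w: "w \<in> ?H \<inter> (\<lambda>a. x \<otimes> a) ` (A0 \<inter> U)"
        then obtain a where a: "a \<in> A0" "a \<in> U" "w = x \<otimes> a" "pi_element (- I) w" by blast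
        have ac: "a \<in> carrier G" using a(2) U_carrier by blast
        have "pi_element (- I) (inv x \<otimes> w)"
          by (rule pi_element_mult[OF pi_split_Compl_I pi_element_inv[OF xc(2)] a(4)])
        moreover have "inv x \<otimes> w = a" using a(3) xc(1) ac by (simp add: m_assoc[symmetric])
        ultimately show "w \<in> ?A" using a A0(2) by auto
      qed
    qed
    then have "openin (subtopology T ?H) ?A"
      using openin_subtopology_Int2[OF open_left_translate[OF xc(1) openin_Int[OF A0(1) U_open]]] by simp
    moreover have "openin L.LPT ((\<lambda>u. y \<otimes>\<^bsub>product_group I Gs\<^esub> u) ` C)"
      by (rule L.open_coset_LPT[OF y AC(2)])
    moreover have "x \<in> ?A"
    proof (rule image_eqI[OF _ AC(3)])
      show "x = x \<otimes> pi_proj (- I) \<one>" using pi_proj_mult[OF pi_split_Compl_I gc one_closed] gc g(2) by simp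
    qed
    moreover have "y \<in> (\<lambda>u. y \<otimes>\<^bsub>product_group I Gs\<^esub> u) ` C"
    proof (rule image_eqI[OF _ AC(4)])
      show "y = y \<otimes>\<^bsub>product_group I Gs\<^esub> coords \<one>"
        unfolding g(3) coords_mult[OF gc one_closed, symmetric] using gc by simp
    qed
    moreover have "?A \<times> (\<lambda>u. y \<otimes>\<^bsub>product_group I Gs\<^esub> u) ` C \<subseteq> factors ` B"
    proof
      fix z assume "z \<in> ?A \<times> (\<lambda>u. y \<otimes>\<^bsub>product_group I Gs\<^esub> u) ` C"
      then obtain a c where ac: "a \<in> A" "c \<in> C" "z = (x \<otimes> a, y \<otimes>\<^bsub>product_group I Gs\<^esub> c)" by blast
      then have "(a, c) \<in> factors ` ?S" using AC(5) by blast
      then obtain v where v: "v \<in> ?S" "a = pi_proj (- I) v" "c = coords v" unfolding factors_def by blast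
      have vc: "v \<in> carrier G" using v(1) U_carrier unfolding tU by blast
      have "z = factors (g \<otimes> v)"
        unfolding factors_def coords_mult[OF gc vc] pi_proj_mult[OF pi_split_Compl_I gc vc] ac(3) v(2,3) g(2,3) ..
      then show "z \<in> factors ` B" using v(1) by blast
    qed
    ultimately show "\<exists>A C. openin (subtopology T ?H) A \<and> openin L.LPT C \<and> x \<in> A \<and> y \<in> C \<and> A \<times> C \<subseteq> factors ` B"
      by blast
  qed
qed

lemma factors_homeomorphic:
  "homeomorphic_map T (prod_topology (subtopology T {g. pi_element (- I) g}) (loc_prod_topology I Gs Xs Us)) factors"
proof (rule bijective_open_imp_homeomorphic_map)
  have "continuous_map T (subtopology T {g. pi_element (- I) g}) (pi_proj (- I))"
    using pi_proj_continuous[OF pi_split_Compl_I] pi_element_pi_proj by (intro continuous_map_into_subtopology) (auto simp: topspace_eq)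
  then show "continuous_map T (prod_topology (subtopology T {g. pi_element (- I) g}) L.LPT) factors"
    unfolding factors_def[abs_def] by (rule continuous_map_pairedI[OF _ coords_continuous])
  show "open_map T (prod_topology (subtopology T {g. pi_element (- I) g}) L.LPT) factors" by (rule factors_open_map)
  have "topspace (subtopology T {g. pi_element (- I) g}) = {g. pi_element (- I) g}" using pi_element_carrier by (auto simp: topspace_eq)
  then show "factors ` topspace T = topspace (prod_topology (subtopology T {g. pi_element (- I) g}) L.LPT)"
    unfolding topspace_prod_topology L.topspace_LPT topspace_eq factors_image by (simp only:)
  show "inj_on factors (topspace T)" unfolding topspace_eq by (rule factors_inj)
qed

end

section \<open>Translation into the notions of the theorem\<close>

lemma G_sigma_eq: "G_sigma G T \<sigma> = {g. pi_element \<sigma> g}"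
  by (simp add: G_sigma_def sigma_element_iff_pi_element)

lemma G_p_eq: "G_p G T p = {g. pi_element {p} g}"
  by (simp add: G_p_def G_sigma_eq)

text \<open>Reconciles the two complements: the theorem removes \<sigma> from the primes, the proof
  removes it from the naturals, and \<open>pi_number\<close> looks at prime divisors only.\<close>

lemma pi_element_primes: "pi_element ({q. Factorial_Ring.prime q} - \<sigma>) g \<longleftrightarrow> pi_element (- \<sigma>) g"
proof -
  have "pi_number ({q. Factorial_Ring.prime q} - \<sigma>) n \<longleftrightarrow> pi_number (- \<sigma>) n" for n
    by (auto simp: pi_number_def)
  then show ?thesis by (simp add: pi_element_def)
qed

lemma nu_split:
  assumes "p \<in> nu G T" shows "pi_split {p}"
  unfolding pi_split_def
proof (intro allI impI)
  fix x y assume x: "pi_element {p} x" and y: "pi_element (- {p}) y"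
  let ?K = "{a \<otimes> b \<otimes> inv a \<otimes> inv b | a b. a \<in> {g. pi_element {p} g} \<and> b \<in> {g. pi_element (- {p}) g}}"
  have "generate G ?K = {\<one>}"
    using assms unfolding nu_def commutator_group_def G_p_eq G_sigma_eq pi_element_primes by blast
  moreover have "x \<otimes> y \<otimes> inv x \<otimes> inv y \<in> generate G ?K"
    using x y by (intro generate.incl) blast
  ultimately have 1: "x \<otimes> y \<otimes> inv x \<otimes> inv y = \<one>" by blast
  have c: "x \<in> carrier G" "y \<in> carrier G" using x y pi_element_carrier by auto
  have "x \<otimes> y = x \<otimes> y \<otimes> inv x \<otimes> inv y \<otimes> (y \<otimes> x)"
  proof -
    have "inv x \<otimes> inv y \<otimes> (y \<otimes> x) = \<one>" using c by (simp add: inv_mult_group[symmetric])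
    then have "(x \<otimes> y) \<otimes> (inv x \<otimes> inv y \<otimes> (y \<otimes> x)) = x \<otimes> y" using c by simp
    then show ?thesis using c by (simp only: m_assoc m_closed inv_closed)
  qed
  also have "\<dots> = y \<otimes> x" using 1 c by simp
  finally show "x \<otimes> y = y \<otimes> x" .
qed

lemma pi_element_normal: "pi_split \<sigma> \<Longrightarrow> {g. pi_element \<sigma> g} \<lhd> G"
  unfolding normal_inv_iff using pi_element_subgroup pi_element_conj by blast

end

theorem theorem5p8:
  fixes G :: "'a monoid" and T :: "'a topology"
  assumes "periodic_group G T" and "compactly_ruled G T"
  shows "closedin T (G_sigma G T ({q. Factorial_Ring.prime q} - nu G T)) \<and>
         G_sigma G T ({q. Factorial_Ring.prime q} - nu G T) \<lhd> G \<and>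
         (\<forall>p\<in>nu G T. sigma_sylow G T {p} (G_p G T p) \<and> G_p G T p \<lhd> G) \<and>
         (\<exists>U :: nat \<Rightarrow> 'a set.
            (\<forall>p\<in>nu G T. subgroup (U p) G \<and> U p \<subseteq> G_p G T p \<and> compactin T (U p) \<and>
                          openin (subtopology T (G_p G T p)) (U p)) \<and>
            (\<exists>\<phi>. \<phi> \<in> iso G (G\<lparr>carrier := G_sigma G T ({q. Factorial_Ring.prime q} - nu G T)\<rparr> \<times>\<times>
                              loc_prod_group (nu G T) (\<lambda>p. G\<lparr>carrier := G_p G T p\<rparr>) U) \<and>
                  homeomorphic_map T
                    (prod_topology (subtopology T (G_sigma G T ({q. Factorial_Ring.prime q} - nu G T)))
                       (loc_prod_topology (nu G T) (\<lambda>p. G\<lparr>carrier := G_p G T p\<rparr>)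
                          (\<lambda>p. subtopology T (G_p G T p)) U)) \<phi>))"
proof -
  interpret ruled_group G T
    using assms unfolding ruled_group_def ruled_group_axioms_def periodic_group_def locally_compact_group_def
      topological_group_def by blast
  have sp: "pi_split {p}" if "p \<in> nu G T" for p using nu_split[OF that] .
  have H: "G_sigma G T ({q. Factorial_Ring.prime q} - nu G T) = {g. pi_element (- nu G T) g}"
    by (simp add: G_sigma_eq pi_element_primes)
  obtain U where U: "compact_open U" using compact_open_exists .
  let ?U = "\<lambda>p. U \<inter> {g. pi_element {p} g}"
  \<comment> \<open>Maximality is automatic once the set of all \<open>p\<close>-elements is a
    subgroup: no larger set consists of \<open>p\<close>-elements.\<close>
  have sylow: "sigma_sylow G T {p} {g. pi_element {p} g}" if "p \<in> nu G T" for p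
    using pi_element_subgroup[OF sp[OF that]] by (auto simp: sigma_sylow_def G_sigma_eq)
  have "subgroup (?U p) G" "?U p \<subseteq> {g. pi_element {p} g}" "compactin T (?U p)"
    "openin (subtopology T {g. pi_element {p} g}) (?U p)" if "p \<in> nu G T" for p
  proof -
    have U': "subgroup U G" "compactin T U" "openin T U" using U by (auto simp: compact_open_subgroup_def)
    show "subgroup (?U p) G" by (rule subgroups_Inter_pair[OF U'(1) pi_element_subgroup[OF sp[OF that]]])
    show "?U p \<subseteq> {g. pi_element {p} g}" by blast
    show "compactin T (?U p)" by (rule compact_Int_closedin[OF U'(2) pi_element_closed])
    show "openin (subtopology T {g. pi_element {p} g}) (?U p)"
      using openin_subtopology_Int[OF U'(3)] by blast
  qed
  note Ufacts = this
  show ?thesis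
    unfolding H G_p_eq
  proof (intro conjI ballI exI[of _ ?U] exI[of _ "factors (nu G T)"])
    show "closedin T {g. pi_element (- nu G T) g}" by (rule pi_element_closed)
    show "{g. pi_element (- nu G T) g} \<lhd> G" by (rule pi_element_normal[OF pi_split_Compl[OF pi_split_Union[OF sp]]])
    show "sigma_sylow G T {p} {g. pi_element {p} g}" if "p \<in> nu G T" for p by (rule sylow[OF that])
    show "{g. pi_element {p} g} \<lhd> G" if "p \<in> nu G T" for p by (rule pi_element_normal[OF sp[OF that]])
  qed (use Ufacts factors_iso[OF sp U] factors_homeomorphic[OF sp U] in blast)+
qed

end
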